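(* Let $k,d\in\mathbb{Z}_+$ with $k\le\sqrt d$, $0<c<1$, $0<\epsilon<1/2$, and $c_1=1/10001$. Let $\mathcal{A}$ be an SQ algorithm that is given access to a distribution of the form $(1-\epsilon)\mathcal{N}(c_1\sqrt\epsilon\,v,\ I_d-(1/3)vv^T)+\epsilon B$, where $v$ is some $k$-sparse unit vector of $\mathbb{R}^d$ and $B$ is some arbitrary noise distribution. If the output of $\mathcal{A}$ is (for every such $v$ and $B$) a vector $u$ with $\|u-c_1\sqrt\epsilon\,v\|_2\le c_1\sqrt\epsilon/4$, then $\mathcal{A}$ either makes $\Omega(d^{ck^c/8}k^{-4+4c})$ queries, or makes at least one query with tolerance $O(k^{-2+2c}e^{O(1/\epsilon)})$.
   Context: SQ model: a statistical query is a bounded function $f:\mathbb{R}^d\to[-1,1]$; the oracle $\mathrm{STAT}(\tau)$ for a distribution $D$ answers with some value $v$ satisfying $|v-\mathbb{E}_{X\sim D}[f(X)]|\le\tau$ ($\tau$ is the tolerance); an SQ algorithm accesses the distribution only through adaptive such queries. *)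

theory Defs
  imports "HOL-Analysis.Analysis" "HOL-Probability.Probability"
begin

text \<open>Vectors of R^d are functions nat => real, indices 0..d-1 (values outside are irrelevant;
  points of the sample space are the extensional functions on {0..<d}). Matrices are
  nat => nat => real, indices 0..d-1.\<close>

definition Rd :: "nat \<Rightarrow> (nat \<Rightarrow> real) measure" where
  "Rd d = PiM {0..<d} (\<lambda>_. lborel)"

definition l2norm :: "nat \<Rightarrow> (nat \<Rightarrow> real) \<Rightarrow> real" where
  "l2norm d x = sqrt (\<Sum>i<d. (x i)\<^sup>2)"

definition sparse :: "nat \<Rightarrow> nat \<Rightarrow> (nat \<Rightarrow> real) \<Rightarrow> bool" where
  "sparse d k v \<longleftrightarrow> card {i\<in>{0..<d}. v i \<noteq> 0} \<le> k"

definition unit_vec :: "nat \<Rightarrow> (nat \<Rightarrow> real) \<Rightarrow> bool" where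
  "unit_vec d v \<longleftrightarrow> v \<in> extensional {0..<d} \<and> l2norm d v = 1"

definition det_d :: "nat \<Rightarrow> (nat \<Rightarrow> nat \<Rightarrow> real) \<Rightarrow> real" where
  "det_d d S = (\<Sum>p | p permutes {0..<d}. of_int (sign p) * (\<Prod>i<d. S i (p i)))"

definition inv_d :: "nat \<Rightarrow> (nat \<Rightarrow> nat \<Rightarrow> real) \<Rightarrow> (nat \<Rightarrow> nat \<Rightarrow> real)" where
  "inv_d d S = (SOME M. \<forall>i<d. \<forall>j<d. (\<Sum>l<d. M i l * S l j) = (if i = j then 1 else 0))"

definition gaussian_density :: "nat \<Rightarrow> (nat \<Rightarrow> real) \<Rightarrow> (nat \<Rightarrow> nat \<Rightarrow> real) \<Rightarrow> (nat \<Rightarrow> real) \<Rightarrow> real" where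
  "gaussian_density d mu S x =
     exp (- (1/2) * (\<Sum>i<d. \<Sum>j<d. (x i - mu i) * inv_d d S i j * (x j - mu j)))
       / sqrt ((2 * pi) ^ d * det_d d S)"

definition mvnormal :: "nat \<Rightarrow> (nat \<Rightarrow> real) \<Rightarrow> (nat \<Rightarrow> nat \<Rightarrow> real) \<Rightarrow> (nat \<Rightarrow> real) measure" where
  "mvnormal d mu S = density (Rd d) (\<lambda>x. ennreal (gaussian_density d mu S x))"

definition mix_measure :: "nat \<Rightarrow> real \<Rightarrow> (nat \<Rightarrow> real) measure \<Rightarrow> (nat \<Rightarrow> real) measure \<Rightarrow> (nat \<Rightarrow> real) measure" where
  "mix_measure d eps P B = measure_of (space (Rd d)) (sets (Rd d))
      (\<lambda>A. ennreal (1 - eps) * emeasure P A + ennreal eps * emeasure B A)"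

text \<open>A (deterministic, adaptive) SQ algorithm A maps the list of oracle answers received so far
  to its next action: Inl (f, tau) = ask the statistical query f with tolerance tau;
  Inr u = halt with output u.\<close>

definition sq_wellformed :: "nat \<Rightarrow> (real list \<Rightarrow> ((nat \<Rightarrow> real) \<Rightarrow> real) \<times> real + 'b) \<Rightarrow> bool" where
  "sq_wellformed d A \<longleftrightarrow> (\<forall>h f tau. A h = Inl (f, tau) \<longrightarrow>
      f \<in> borel_measurable (Rd d) \<and> (\<forall>x. \<bar>f x\<bar> \<le> 1) \<and> tau > 0)"

definition sq_queries_upto :: "(real list \<Rightarrow> ('a \<Rightarrow> real) \<times> real + 'b) \<Rightarrow> (nat \<Rightarrow> real) \<Rightarrow> nat \<Rightarrow> bool" where
  "sq_queries_upto A ans n \<longleftrightarrow> (\<forall>i<n. \<exists>q. A (map ans [0..<i]) = Inl q)"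

definition sq_valid_answers :: "(real list \<Rightarrow> ('a \<Rightarrow> real) \<times> real + 'b) \<Rightarrow> 'a measure \<Rightarrow> (nat \<Rightarrow> real) \<Rightarrow> bool" where
  "sq_valid_answers A D ans \<longleftrightarrow> (\<forall>i f tau. sq_queries_upto A ans i \<longrightarrow>
      A (map ans [0..<i]) = Inl (f, tau) \<longrightarrow> \<bar>ans i - integral\<^sup>L D f\<bar> \<le> tau)"

definition sq_outputs :: "(real list \<Rightarrow> ('a \<Rightarrow> real) \<times> real + 'b) \<Rightarrow> (nat \<Rightarrow> real) \<Rightarrow> nat \<Rightarrow> 'b \<Rightarrow> bool" where
  "sq_outputs A ans n u \<longleftrightarrow> sq_queries_upto A ans n \<and> A (map ans [0..<n]) = Inr u"

definition c1 :: real where "c1 = 1 / 10001"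

definition hard_dist :: "nat \<Rightarrow> real \<Rightarrow> (nat \<Rightarrow> real) \<Rightarrow> (nat \<Rightarrow> real) measure \<Rightarrow> (nat \<Rightarrow> real) measure" where
  "hard_dist d eps v B = mix_measure d eps
      (mvnormal d (\<lambda>i. c1 * sqrt eps * v i)
         (\<lambda>i j. (if i = j then 1 else 0) - (1/3) * v i * v j)) B"

definition admissible_noise :: "nat \<Rightarrow> (nat \<Rightarrow> real) measure \<Rightarrow> bool" where
  "admissible_noise d B \<longleftrightarrow> prob_space B \<and> sets B = sets (Rd d)"

end

theory Submission
  imports Defs
begin

text \<open>
  For a unit vector \<open>v\<close> let the noise be a mixture, in direction \<open>v\<close>, of two unit-variance Gaussians chosen
  such that the contaminated distribution \<open>P\<^sub>v\<close> has the same first three moments along \<open>v\<close> as a standard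
  Gaussian; the two means are of order \<open>1 / sqrt eps\<close>. The likelihood ratio of \<open>P\<^sub>v\<close> against the standard
  Gaussian is then \<open>q (v \<bullet> x)\<close> with \<open>q y = E (exp (\<theta> y - \<theta>\<^sup>2 / 2))\<close> for a complex random variable \<open>\<theta>\<close>
  (a component of variance \<open>1 - b\<^sup>2\<close> contributes \<open>a + \<i> b z\<close> with \<open>z\<close> standard normal), and the inner
  product of two such ratios is \<open>E (exp (\<rho> \<theta> \<theta>'))\<close>, where \<open>\<rho> = u \<bullet> v\<close> and \<open>\<theta>'\<close> is an independent copy
  of \<open>\<theta>\<close>. As \<open>\<theta>\<close> has vanishing moments of order 1, 2, 3, Taylor's formula bounds the
  correlation by \<open>\<rho>\<^sup>4 exp (O(1 / eps))\<close>.

  By the Gilbert--Varshamov bound there are many \<open>k\<close>-sparse unit vectors with pairwise inner products at most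
  \<open>k powr (c - 1)\<close>. A second moment argument shows that a query can tell only few of the corresponding \<open>P\<^sub>v\<close>
  from the standard Gaussian, so an oracle that answers as if the distribution were standard Gaussian is valid for at
  least two of them unless many queries are made, while no output is close to two of the means.
\<close>

section \<open>Rank-one perturbations of the identity\<close>

text \<open>The moments of \<open>\<theta>\<close> are the Hermite moments of the law with
  likelihood ratio \<open>q\<close>, which is why three matched moments make the correlation start
  at \<open>\<rho> ^ 4\<close>. With \<open>\<rho>\<close> at most \<open>k powr (c - 1)\<close>
  this explains both exponents of the theorem: up to factors depending on \<open>eps\<close>, a
  tolerance above \<open>\<rho>\<^sup>2\<close> lets a query exclude at most
  \<open>2 / \<rho> ^ 4\<close> vectors. Matching is possible because the clean part has variance
  2/3 along \<open>v\<close> and a mean of order \<open>sqrt eps\<close>. The noise then needs a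
  second moment of order \<open>1 / eps\<close>, and since \<open>c1\<close> is small this exceeds
  the square of the mean that it needs. Noise components of unit variance have real constant
  \<open>\<theta>\<close>, so it is enough to find a two-point law with three prescribed moments.
  Its points are at most \<open>3 / sqrt eps\<close> in absolute value, which is the source of
  \<open>exp (9 / eps)\<close>. The constants have to be absolute, so parameters for which the code
  is too small, or its vectors are not nearly orthogonal, must be covered as well. There two
  antipodal vectors take the place of the code.\<close>

lemma sum_sign_permutes_eq_0:
  assumes "finite T" "i \<in> T" "j \<in> T" "i \<noteq> j"
  shows "(\<Sum>p | p permutes T. of_int (sign p) :: real) = 0"
proof -
  let ?P = "{p. p permutes T}" and ?t = "Transposition.transpose i j"
  have t: "?t permutes T" using assms by (simp add: permutes_swap_id)
  have "(\<Sum>p\<in>?P. of_int (sign p) :: real) = (\<Sum>p\<in>?P. of_int (sign (?t \<circ> p)))"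
    by (rule setum_permutations_compose_left[OF t])
  also have "\<dots> = (\<Sum>p\<in>?P. - of_int (sign p))"
  proof (rule sum.cong[OF refl])
    fix p assume "p \<in> ?P"
    then have "permutation p" using assms permutation_permutes by blast
    then show "(of_int (sign (?t \<circ> p)) :: real) = - of_int (sign p)"
      using assms by (simp add: sign_compose permutation_swap_id sign_swap_id)
  qed
  also have "\<dots> = - (\<Sum>p\<in>?P. of_int (sign p))" by (simp add: sum_negf)
  finally show ?thesis by simp
qed

text \<open>Expand each product over the set \<open>T\<close> of rows from which the rank-one entry
  is taken. Only permutations fixing everything outside \<open>T\<close> survive, and for them the
  product does not depend on the permutation. What remains is the sum of the signs of the
  permutations of \<open>T\<close>, which vanishes once \<open>T\<close> has two elements.\<close>

lemma det_d_rank_one: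
  "det_d d (\<lambda>i j. (if i = j then 1 else 0) + x i * y j) = 1 + (\<Sum>i<d. x i * y i)"
proof -
  let ?I = "{0..<d}"
  let ?g = "\<lambda>p T. of_int (sign p) * ((\<Prod>i\<in>T. x i * y (p i)) * (\<Prod>i\<in>?I - T. if i = p i then 1 else 0 :: real))"
  have "det_d d (\<lambda>i j. (if i = j then 1 else 0) + x i * y j)
    = (\<Sum>p | p permutes ?I. of_int (sign p) * (\<Prod>i\<in>?I. x i * y (p i) + (if i = p i then 1 else 0)))"
    by (simp add: det_d_def lessThan_atLeast0 add.commute)
  also have "\<dots> = (\<Sum>p | p permutes ?I. \<Sum>T\<in>Pow ?I. ?g p T)"
    by (simp add: prod_add sum_distrib_left)
  also have "\<dots> = (\<Sum>T\<in>Pow ?I. \<Sum>p | p permutes ?I. ?g p T)"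
    by (rule sum.swap)
  also have "\<dots> = (\<Sum>T\<in>Pow ?I. (\<Prod>i\<in>T. x i * y i) * (\<Sum>p | p permutes T. of_int (sign p)))"
  proof (rule sum.cong[OF refl])
    fix T assume "T \<in> Pow ?I"
    then have T: "T \<subseteq> ?I" by blast
    have "(\<Sum>p | p permutes ?I. ?g p T) = (\<Sum>p | p permutes T. ?g p T)"
    proof (rule sum.mono_neutral_right)
      show "finite {p. p permutes ?I}" by (simp add: finite_permutations)
      show "{p. p permutes T} \<subseteq> {p. p permutes ?I}" using T permutes_subset by blast
      show "\<forall>p\<in>{p. p permutes ?I} - {p. p permutes T}. ?g p T = 0"
      proof
        fix p assume p: "p \<in> {p. p permutes ?I} - {p. p permutes T}"
        then obtain i where "i \<in> ?I - T" "p i \<noteq> i"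
          using permutes_superset[of p ?I T] by blast
        then have "(\<Prod>i\<in>?I - T. if i = p i then 1 else 0 :: real) = 0"
          by (intro prod_zero) (simp, metis)
        then show "?g p T = 0" by simp
      qed
    qed
    also have "\<dots> = (\<Sum>p | p permutes T. of_int (sign p) * (\<Prod>i\<in>T. x i * y i))"
    proof (rule sum.cong[OF refl])
      fix p assume "p \<in> {p. p permutes T}"
      then have p: "p permutes T" by simp
      have "(\<Prod>i\<in>?I - T. if i = p i then 1 else 0 :: real) = 1"
        using permutes_not_in[OF p] by (intro prod.neutral) auto
      moreover have "(\<Prod>i\<in>T. y (p i)) = (\<Prod>i\<in>T. y i)"
        using prod.permute[OF p, of y] by (simp add: comp_def)
      ultimately show "?g p T = of_int (sign p) * (\<Prod>i\<in>T. x i * y i)"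
        by (simp add: prod.distrib)
    qed
    finally show "(\<Sum>p | p permutes ?I. ?g p T) = (\<Prod>i\<in>T. x i * y i) * (\<Sum>p | p permutes T. of_int (sign p))"
      by (simp add: sum_distrib_left mult.commute)
  qed
  also have "\<dots> = (\<Sum>T\<in>insert {} ((\<lambda>i. {i}) ` ?I). (\<Prod>i\<in>T. x i * y i) * (\<Sum>p | p permutes T. of_int (sign p)))"
  proof (rule sum.mono_neutral_right)
    show "\<forall>T\<in>Pow ?I - insert {} ((\<lambda>i. {i}) ` ?I). (\<Prod>i\<in>T. x i * y i) * (\<Sum>p | p permutes T. of_int (sign p)) = 0"
    proof
      fix T assume T: "T \<in> Pow ?I - insert {} ((\<lambda>i. {i}) ` ?I)"
      then obtain i where i: "i \<in> T" by auto
      with T obtain j where j: "j \<in> T" "i \<noteq> j" by blast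
      have "finite T" using T finite_subset[of T ?I] by blast
      then show "(\<Prod>i\<in>T. x i * y i) * (\<Sum>p | p permutes T. of_int (sign p)) = 0"
        using sum_sign_permutes_eq_0[OF _ i j] by simp
    qed
  qed auto
  also have "\<dots> = 1 + (\<Sum>i<d. x i * y i)"
    by (subst sum.insert) (auto simp: sum.reindex permutes_sing sign_id lessThan_atLeast0)
  finally show ?thesis .
qed

text \<open>Sherman-Morrison: \<open>(I + p v v^T) (I + q v v^T)\<close> is the identity iff
  \<open>p + q + p * q = 0\<close>, which holds for -1/3 and 1/2. Since \<open>inv_d\<close> is some
  chosen left inverse, it also has to be identified:
  \<open>M = M (S N) = (M S) N = N\<close>.\<close>

lemma inv_d_rank_one:
  assumes v: "(\<Sum>l<d. v l * v l) = 1" and ij: "i < d" "j < d"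
  shows "inv_d d (\<lambda>i j. (if i = j then 1 else 0) - (1/3) * v i * v j) i j
     = (if i = j then 1 else 0) + (1/2) * v i * v j"
proof -
  let ?S = "\<lambda>i j. (if i = j then 1 else 0) - (1/3) * v i * v j"
  let ?N = "\<lambda>i j. (if i = j then 1 else 0) + (1/2) * v i * v j"
  have exp2: "(\<Sum>l<d. ((if a = l then 1 else 0) + p * v a * v l) * ((if l = b then 1 else 0) + q * v l * v b))
     = (if a = b then 1 else 0) + (p + q + p * q) * v a * v b" if "a < d" "b < d" for a b p q
  proof -
    have "((if a = l then 1 else 0) + p * v a * v l) * ((if l = b then 1 else 0) + q * v l * v b)
      = (if l = a then (if a = b then 1 else 0) + q * v a * v b else 0) + (if l = b then p * v a * v b else 0)
         + p * q * v a * v b * (v l * v l)" for l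
      by (auto simp: algebra_simps)
    then have "(\<Sum>l<d. ((if a = l then 1 else 0) + p * v a * v l) * ((if l = b then 1 else 0) + q * v l * v b))
      = (if a = b then 1 else 0) + q * v a * v b + p * v a * v b + p * q * v a * v b * (\<Sum>l<d. v l * v l)"
      using that by (simp add: sum.distrib sum_distrib_left[symmetric] lessThan_iff)
    then show ?thesis using v by (simp add: algebra_simps)
  qed
  have SN: "(\<Sum>l<d. ?S a l * ?N l b) = (if a = b then 1 else 0)" if "a < d" "b < d" for a b
    using exp2[OF that, of "-1/3" "1/2"] by simp
  have NS: "(\<Sum>l<d. ?N a l * ?S l b) = (if a = b then 1 else 0)" if "a < d" "b < d" for a b
    using exp2[OF that, of "1/2" "-1/3"] by simp
  define M where "M = inv_d d ?S"
  have "\<forall>i<d. \<forall>j<d. (\<Sum>l<d. M i l * ?S l j) = (if i = j then 1 else 0)"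
    unfolding M_def inv_d_def by (rule someI[where x = ?N]) (use NS in blast)
  then have M: "(\<Sum>l<d. M a l * ?S l b) = (if a = b then 1 else 0)" if "a < d" "b < d" for a b
    using that by blast
  have "M i j = (\<Sum>l<d. M i l * (if l = j then 1 else 0))"
    using ij by (subst sum.cong[OF refl, of _ _ "\<lambda>l. if l = j then M i l else 0"]) auto
  also have "\<dots> = (\<Sum>l<d. M i l * (\<Sum>m<d. ?S l m * ?N m j))"
    by (rule sum.cong[OF refl]) (use SN[OF _ ij(2)] in simp)
  also have "\<dots> = (\<Sum>m<d. (\<Sum>l<d. M i l * ?S l m) * ?N m j)"
    unfolding sum_distrib_left sum_distrib_right mult.assoc by (rule sum.swap)
  also have "\<dots> = (\<Sum>m<d. (if i = m then 1 else 0) * ?N m j)"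
    by (rule sum.cong[OF refl]) (use M[OF ij(1)] in simp)
  also have "\<dots> = ?N i j" using ij
    by (subst sum.cong[OF refl, of _ _ "\<lambda>m. if m = i then ?N i j else 0"]) auto
  finally show ?thesis by (simp add: M_def)
qed

section \<open>Codes with small agreement\<close>

definition agree :: "nat \<Rightarrow> (nat \<Rightarrow> nat) \<Rightarrow> (nat \<Rightarrow> nat) \<Rightarrow> nat" where
  "agree k f g = card {j\<in>{..<k}. f j = g j}"

lemma agree_commute: "agree k f g = agree k g f"
  unfolding agree_def by (rule arg_cong[where f=card]) auto

lemma finite_maximal_set:
  assumes "finite U" and "P {}"
  shows "\<exists>S\<subseteq>U. P S \<and> (\<forall>x\<in>U - S. \<not> P (insert x S))"
proof -
  let ?F = "{S. S \<subseteq> U \<and> P S}"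
  have "finite ?F" "{} \<in> ?F" using assms by auto
  then obtain S where S: "S \<in> ?F" "\<And>T. T \<in> ?F \<Longrightarrow> S \<subseteq> T \<Longrightarrow> S = T"
    using finite_has_maximal[of ?F] by auto
  have "\<not> P (insert x S)" if "x \<in> U - S" for x
    using S(2)[of "insert x S"] S(1) that by blast
  then show ?thesis using S(1) by blast
qed

text \<open>The balls around the words of a maximal code cover the whole space.\<close>
lemma exists_code:
  fixes k q t :: nat
  assumes "t \<le> k" "q > 0" "t > 0"
  shows "\<exists>S. S \<subseteq> PiE {..<k} (\<lambda>_. {..<q}) \<and>
    (\<forall>f\<in>S. \<forall>g\<in>S. f \<noteq> g \<longrightarrow> agree k f g < t) \<and> q ^ t \<le> card S * (k choose t)"
proof -
  let ?U = "PiE {..<k} (\<lambda>_. {..<q})"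
  have fU: "finite ?U" by (intro finite_PiE) auto
  define Q where "Q S \<longleftrightarrow> (\<forall>f\<in>S. \<forall>g\<in>S. f \<noteq> g \<longrightarrow> agree k f g < t)" for S
  have "\<exists>S\<subseteq>?U. Q S \<and> (\<forall>x\<in>?U - S. \<not> Q (insert x S))"
    by (rule finite_maximal_set[OF fU]) (simp add: Q_def)
  then obtain S where S: "S \<subseteq> ?U" "Q S" and mx: "\<forall>x\<in>?U - S. \<not> Q (insert x S)"
    by (elim exE conjE) (rule that)
  have fS: "finite S" using S(1) fU finite_subset by blast
  \<comment> \<open>The words that agree with \<open>f\<close> on \<open>T\<close>. A ball is the
    union of these sets over all \<open>T\<close> of size \<open>t\<close>, and each has
    \<open>q ^ (k - t)\<close> elements.\<close>
  let ?B = "\<lambda>f T. PiE {..<k} (\<lambda>j. if j \<in> T then {f j} else {..<q})"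
  let ?Ts = "{T. T \<subseteq> {..<k} \<and> card T = t}"
  have "?U \<subseteq> (\<Union>f\<in>S. \<Union>T\<in>?Ts. ?B f T)"
  proof
    fix x assume x: "x \<in> ?U"
    have "\<exists>f\<in>S. t \<le> agree k x f"
    proof (cases "x \<in> S")
      case True
      have "agree k x x = k" by (simp add: agree_def)
      then show ?thesis using True assms by (intro bexI[of _ x]) auto
    next
      case False
      then have "\<not> Q (insert x S)" using mx x by blast
      then obtain f where "f \<in> S" "\<not> agree k x f < t \<or> \<not> agree k f x < t"
        using S(2) unfolding Q_def by blast
      then show ?thesis using agree_commute[of k x f] by (auto intro!: bexI[of _ f])
    qed
    then obtain f where f: "f \<in> S" "t \<le> card {j\<in>{..<k}. x j = f j}" by (auto simp: agree_def)
    obtain T where T: "T \<subseteq> {j\<in>{..<k}. x j = f j}" "card T = t"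
      using f(2) by (rule obtain_subset_with_card_n) blast
    then have "x \<in> ?B f T" using x by (auto simp: PiE_def Pi_def)
    then show "x \<in> (\<Union>f\<in>S. \<Union>T\<in>?Ts. ?B f T)" using f T by blast
  qed
  then have "card ?U \<le> card (\<Union>f\<in>S. \<Union>T\<in>?Ts. ?B f T)"
    using fS by (intro card_mono finite_UN_I finite_PiE) auto
  also have "\<dots> \<le> (\<Sum>f\<in>S. card (\<Union>T\<in>?Ts. ?B f T))"
    by (rule card_UN_le[OF fS])
  also have "\<dots> \<le> (\<Sum>f\<in>S. \<Sum>T\<in>?Ts. card (?B f T))"
    by (intro sum_mono card_UN_le) auto
  also have "\<dots> = (\<Sum>f\<in>S. \<Sum>T\<in>?Ts. q ^ (k - t))"
  proof (intro sum.cong refl)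
    fix f T assume T: "T \<in> ?Ts"
    have "card (?B f T) = (\<Prod>j\<in>{..<k}. if j \<in> T then 1 else q)"
      by (subst card_PiE) (auto intro!: prod.cong)
    also have "\<dots> = (\<Prod>j\<in>{..<k} - T. q)"
      by (rule prod.mono_neutral_cong_right) auto
    also have "\<dots> = q ^ (k - t)" using T finite_subset[of T "{..<k}"] by (simp add: card_Diff_subset)
    finally show "card (?B f T) = q ^ (k - t)" .
  qed
  also have "\<dots> = card S * (k choose t) * q ^ (k - t)"
    by (simp add: n_subsets)
  finally have "q ^ k \<le> card S * (k choose t) * q ^ (k - t)"
    by (simp add: card_PiE)
  moreover have "q ^ k = q ^ t * q ^ (k - t)" using assms by (simp flip: power_add)
  ultimately have "q ^ t \<le> card S * (k choose t)" using assms by simp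
  then show ?thesis using S unfolding Q_def by blast
qed

text \<open>The binomial coefficient is at most \<open>k ^ t / fact t\<close>, and
  \<open>t ^ t / fact t\<close> is a single term of the series of \<open>exp t\<close>.\<close>

lemma binomial_bound:
  fixes t k :: nat
  assumes "t > 0"
  shows "real (k choose t) \<le> (exp 1 * real k / real t) ^ t"
proof -
  have "real t ^ t / fact t \<le> exp (real t)"
  proof -
    have "(\<Sum>n\<in>{t}. real t ^ n /\<^sub>R fact n) \<le> (\<Sum>n. real t ^ n /\<^sub>R fact n)"
      by (rule sum_le_suminf[OF summable_exp_generic]) auto
    then show ?thesis by (simp add: exp_def divide_inverse mult.commute)
  qed
  then have 1: "real t ^ t \<le> exp (real t) * fact t" by (simp add: field_simps)
  have 2: "real (k choose t) * fact t \<le> real k ^ t"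
    using binomial_fact_pow[of k t] by (metis of_nat_fact of_nat_le_iff of_nat_mult of_nat_power)
  have "real (k choose t) * real t ^ t \<le> real (k choose t) * (exp (real t) * fact t)"
    using 1 by (intro mult_left_mono) auto
  also have "\<dots> \<le> exp (real t) * real k ^ t" using 2 by (simp add: mult.left_commute)
  also have "exp (real t) = exp 1 ^ t" by (simp add: exp_of_nat_mult[symmetric])
  finally have "real (k choose t) * real t ^ t \<le> (exp 1 * real k) ^ t" by (simp add: power_mult_distrib)
  then show ?thesis using assms by (simp add: power_divide pos_le_divide_eq)
qed

section \<open>Exponential integrals for the standard Gaussian\<close>

definition stdG :: "nat \<Rightarrow> (nat \<Rightarrow> real) measure" where
  "stdG d = PiM {0..<d} (\<lambda>_. std_normal_distribution)"

definition dotp :: "nat \<Rightarrow> (nat \<Rightarrow> real) \<Rightarrow> (nat \<Rightarrow> real) \<Rightarrow> real" where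
  "dotp d u x = (\<Sum>i<d. u i * x i)"

lemma sets_stdG [measurable_cong]: "sets (stdG d) = sets (Rd d)"
  unfolding stdG_def Rd_def by (intro sets_PiM_cong) auto

lemma product_prob_std_normal: "product_prob_space (\<lambda>_::nat. std_normal_distribution)"
  using real_dist_normal_dist
  by (auto intro!: product_prob_spaceI simp: real_distribution_def)

lemma prob_space_stdG: "prob_space (stdG d)"
proof -
  interpret product_prob_space "\<lambda>_::nat. std_normal_distribution"
    by (rule product_prob_std_normal)
  show ?thesis unfolding stdG_def by (rule prob_space_PiM) (rule prob_space)
qed

lemma dotp_measurable [measurable]: "dotp d u \<in> borel_measurable (Rd d)"
proof -
  have "(\<lambda>x. \<Sum>i<d. u i * x i) \<in> borel_measurable (Rd d)"
    unfolding Rd_def by measurable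
  then show ?thesis by (simp add: dotp_def[abs_def])
qed

text \<open>Links the product measure, over which integrals factor, to the Lebesgue densities by
  which \<open>mvnormal\<close> is defined.\<close>

lemma stdG_eq_density:
  "stdG d = density (Rd d) (\<lambda>x. ennreal (\<Prod>i<d. std_normal_density (x i)))"
proof -
  interpret N: product_prob_space "\<lambda>_::nat. std_normal_distribution"
    by (rule product_prob_std_normal)
  interpret L: product_sigma_finite "\<lambda>_::nat. lborel :: real measure" ..
  have "density (Rd d) (\<lambda>x. ennreal (\<Prod>i<d. std_normal_density (x i)))
      = PiM {0..<d} (\<lambda>_. std_normal_distribution)"
  proof (rule N.PiM_eqI)
    show "sets (density (Rd d) (\<lambda>x. ennreal (\<Prod>i<d. std_normal_density (x i))))
      = sets (PiM {0..<d} (\<lambda>_. std_normal_distribution))"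
      using sets_stdG[of d] by (simp add: stdG_def)
    fix A :: "nat \<Rightarrow> real set"
    assume A: "\<And>i. i \<in> {0..<d} \<Longrightarrow> A i \<in> sets std_normal_distribution"
    then have A': "\<And>i. i \<in> {0..<d} \<Longrightarrow> A i \<in> sets borel" by auto
    have P: "Pi\<^sub>E {0..<d} A \<in> sets (Rd d)"
      unfolding Rd_def using A' by (intro sets_PiM_I_finite) auto
    have "emeasure (density (Rd d) (\<lambda>x. ennreal (\<Prod>i<d. std_normal_density (x i)))) (Pi\<^sub>E {0..<d} A)
       = (\<integral>\<^sup>+ x. ennreal (\<Prod>i<d. std_normal_density (x i)) * indicator (Pi\<^sub>E {0..<d} A) x \<partial>Rd d)"
      by (rule emeasure_density) (use P in \<open>auto simp: Rd_def\<close>)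
    also have "\<dots> = (\<integral>\<^sup>+ x. (\<Prod>i\<in>{0..<d}. ennreal (std_normal_density (x i)) * indicator (A i) (x i)) \<partial>Rd d)"
    proof (rule nn_integral_cong)
      fix x assume "x \<in> space (Rd d)"
      then have x: "x \<in> extensional {0..<d}" by (auto simp: Rd_def space_PiM PiE_def)
      have 1: "(\<Prod>i\<in>{0..<d}. indicator (A i) (x i)) = (indicator (Pi\<^sub>E {0..<d} A) x :: ennreal)"
        using x by (auto simp: indicator_def PiE_def Pi_def)
      show "ennreal (\<Prod>i<d. std_normal_density (x i)) * indicator (Pi\<^sub>E {0..<d} A) x
         = (\<Prod>i\<in>{0..<d}. ennreal (std_normal_density (x i)) * indicator (A i) (x i))"
        unfolding prod.distrib 1 by (simp add: prod_ennreal lessThan_atLeast0)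
    qed
    also have "\<dots> = (\<Prod>i\<in>{0..<d}. \<integral>\<^sup>+ x. ennreal (std_normal_density x) * indicator (A i) x \<partial>lborel)"
      unfolding Rd_def by (rule L.product_nn_integral_prod) (use A' in auto)
    also have "\<dots> = (\<Prod>i\<in>{0..<d}. emeasure std_normal_distribution (A i))"
      by (intro prod.cong refl) (use A' in \<open>auto simp: emeasure_density\<close>)
    finally show "emeasure (density (Rd d) (\<lambda>x. ennreal (\<Prod>i<d. std_normal_density (x i)))) (Pi\<^sub>E {0..<d} A)
      = (\<Prod>i\<in>{0..<d}. emeasure std_normal_distribution (A i))" .
  qed simp
  then show ?thesis by (simp add: stdG_def)
qed

lemma has_bochner_integral_std_normal_iff:
  fixes f :: "real \<Rightarrow> 'a::{banach, second_countable_topology}"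
  assumes "f \<in> borel_measurable borel"
  shows "has_bochner_integral std_normal_distribution f c \<longleftrightarrow>
    has_bochner_integral lborel (\<lambda>x. std_normal_density x *\<^sub>R f x) c"
  using assms by (simp add: has_bochner_integral_iff integrable_density integral_density)

text \<open>Tilting by the real factor shifts the mean, so only the characteristic function is needed.\<close>
lemma std_normal_complex_mgf:
  fixes a :: complex
  shows "has_bochner_integral std_normal_distribution (\<lambda>x. exp (a * of_real x)) (exp (a\<^sup>2 / 2))"
proof -
  define \<alpha> t where "\<alpha> = Re a" and "t = Im a"
  have a: "a = of_real \<alpha> + \<i> * of_real t" by (simp add: \<alpha>_def t_def complex_eq)
  interpret real_distribution std_normal_distribution by (rule real_dist_normal_dist)
  have "has_bochner_integral std_normal_distribution (\<lambda>x. iexp (t * x)) (exp (- (t\<^sup>2) / 2))"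
    using char_std_normal_distribution integrable_iexp[of "\<lambda>x. t * x"]
    by (auto simp: has_bochner_integral_iff char_def fun_eq_iff)
  then have "has_bochner_integral lborel (\<lambda>x. std_normal_density x *\<^sub>R iexp (t * x)) (exp (- (t\<^sup>2) / 2))"
    by (subst (asm) has_bochner_integral_std_normal_iff) auto
  \<comment> \<open>Translate by \<open>\<alpha>\<close>; the constant factor introduced next
    completes the square.\<close>
  then have "has_bochner_integral lborel (\<lambda>x. std_normal_density (-\<alpha> + 1 * x) *\<^sub>R iexp (t * (-\<alpha> + 1 * x)))
     (exp (- (t\<^sup>2) / 2) /\<^sub>R \<bar>1\<bar>)"
    by (subst (asm) lborel_has_bochner_integral_real_affine_iff[of 1 _ _ "-\<alpha>"]) auto
  then have "has_bochner_integral lborel (\<lambda>x. exp (of_real (\<alpha>\<^sup>2/2) + \<i> * of_real (t*\<alpha>)) * (std_normal_density (-\<alpha> + 1 * x) *\<^sub>R iexp (t * (-\<alpha> + 1 * x))))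
     (exp (of_real (\<alpha>\<^sup>2/2) + \<i> * of_real (t*\<alpha>)) * (exp (- (t\<^sup>2) / 2) /\<^sub>R \<bar>1\<bar>))"
    by (intro has_bochner_integral_mult_right) auto
  also have "(\<lambda>x. exp (of_real (\<alpha>\<^sup>2/2) + \<i> * of_real (t*\<alpha>)) * (std_normal_density (-\<alpha> + 1 * x) *\<^sub>R iexp (t * (-\<alpha> + 1 * x))))
     = (\<lambda>x. std_normal_density x *\<^sub>R exp (a * of_real x))"
  proof
    fix x
    have dens: "std_normal_density y *\<^sub>R z = of_real (1 / sqrt (2 * pi)) * (of_real (exp (- y\<^sup>2 / 2)) * z)"
      for y and z :: complex
      by (simp add: std_normal_density_def scaleR_conv_of_real)
    have 1: "exp (of_real (\<alpha>\<^sup>2/2) + \<i> * of_real (t*\<alpha>)) * (of_real (exp (- (-\<alpha>+1*x)\<^sup>2/2)) * iexp (t * (-\<alpha> + 1*x)))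
        = of_real (exp (- x\<^sup>2/2)) * exp (a * of_real x)"
      unfolding exp_of_real[symmetric] exp_add[symmetric] a
      by (rule arg_cong[where f=exp]) (simp add: field_simps power2_eq_square)
    show "exp (of_real (\<alpha>\<^sup>2/2) + \<i> * of_real (t*\<alpha>)) * (std_normal_density (-\<alpha> + 1 * x) *\<^sub>R iexp (t * (-\<alpha> + 1 * x)))
       = std_normal_density x *\<^sub>R exp (a * of_real x)"
      unfolding dens mult.left_commute[of "exp _" "of_real (1 / _)"] 1 ..
  qed
  also have "exp (of_real (\<alpha>\<^sup>2/2) + \<i> * of_real (t*\<alpha>)) * (exp (- (t\<^sup>2) / 2) /\<^sub>R \<bar>1\<bar>) = exp (a\<^sup>2/2)"
  proof -
    have "exp (of_real (\<alpha>\<^sup>2/2) + \<i> * of_real (t*\<alpha>)) * of_real (exp (- (t\<^sup>2) / 2)) = exp (a\<^sup>2/2)"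
      unfolding exp_of_real[symmetric] exp_add[symmetric] a
      by (rule arg_cong[where f=exp]) (simp add: field_simps power2_eq_square)
    then show ?thesis by (simp add: scaleR_conv_of_real)
  qed
  finally show ?thesis
    by (subst has_bochner_integral_std_normal_iff) auto
qed

text \<open>Rescaling by \<open>sqrt (1 - s)\<close> absorbs the quadratic exponent into the
  Gaussian weight. With \<open>s = b\<^sup>2\<close> this yields the ratio of a component of
  variance \<open>1 - b\<^sup>2\<close>, with \<open>t = 0\<close> and
  \<open>s = 2 * b\<^sup>2\<close> the exponential moment behind \<open>\<Gamma>\<close>.\<close>

lemma std_normal_quadratic:
  assumes s: "s < 1"
  shows "has_bochner_integral std_normal_distribution
     (\<lambda>x. exp (\<i> * of_real (t * x) + of_real (s * x\<^sup>2 / 2)))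
     (complex_of_real (exp (- t\<^sup>2 / (2 * (1 - s))) / sqrt (1 - s)))"
proof -
  define r where "r = sqrt (1 - s)"
  have r: "r > 0" "r\<^sup>2 = 1 - s" using s by (auto simp: r_def)
  have "has_bochner_integral lborel (\<lambda>x. std_normal_density x *\<^sub>R exp (\<i> * of_real (t/r) * of_real x)) (exp ((\<i> * of_real (t/r))\<^sup>2/2))"
    using std_normal_complex_mgf[of "\<i> * of_real (t/r)"]
    by (subst (asm) has_bochner_integral_std_normal_iff) auto
  then have "has_bochner_integral lborel (\<lambda>x. std_normal_density (0 + r * x) *\<^sub>R exp (\<i> * of_real (t/r) * of_real (0 + r*x))) (exp ((\<i> * of_real (t/r))\<^sup>2/2) /\<^sub>R \<bar>r\<bar>)"
    using r by (subst (asm) lborel_has_bochner_integral_real_affine_iff[of r _ _ 0]) auto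
  also have "(\<lambda>x. std_normal_density (0 + r * x) *\<^sub>R exp (\<i> * of_real (t/r) * of_real (0 + r*x)))
    = (\<lambda>x. std_normal_density x *\<^sub>R exp (\<i> * of_real (t * x) + of_real (s * x\<^sup>2 / 2)))"
  proof
    fix x
    have 1: "- (r*x)\<^sup>2/2 = -x\<^sup>2/2 + s*x\<^sup>2/2" unfolding power_mult_distrib r(2) by (simp add: field_simps)
    have "std_normal_density (0+r*x) = std_normal_density x * exp (s*x\<^sup>2/2)"
      unfolding std_normal_density_def add_0 1 exp_add by simp
    moreover have "exp (\<i> * complex_of_real (t * x) + complex_of_real (s * x\<^sup>2 / 2))
        = of_real (exp (s * x\<^sup>2 / 2)) * exp (\<i> * of_real (t * x))"
      by (simp only: exp_add exp_of_real mult.commute)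
    ultimately show "std_normal_density (0 + r * x) *\<^sub>R exp (\<i> * of_real (t/r) * of_real (0 + r*x))
      = std_normal_density x *\<^sub>R exp (\<i> * of_real (t * x) + of_real (s * x\<^sup>2 / 2))"
      using r by (simp add: scaleR_conv_of_real)
  qed
  also have "exp ((\<i> * of_real (t/r))\<^sup>2/2) /\<^sub>R \<bar>r\<bar> = complex_of_real (exp (- t\<^sup>2 / (2 * (1 - s))) / sqrt (1 - s))"
  proof -
    have 1: "(\<i> * complex_of_real (t/r))\<^sup>2/2 = of_real (- t\<^sup>2 / (2 * (1 - s)))"
      unfolding r(2)[symmetric] by (simp add: power_mult_distrib power_divide)
    have 2: "sqrt (1 - s) = r" by (simp add: r_def)
    show ?thesis unfolding 1 2 exp_of_real using r(1)
      by (simp add: scaleR_conv_of_real divide_inverse mult.commute)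
  qed
  finally show ?thesis
    by (subst has_bochner_integral_std_normal_iff) auto
qed

lemma stdG_complex_mgf:
  fixes w :: "nat \<Rightarrow> complex"
  shows "has_bochner_integral (stdG d) (\<lambda>x. exp (\<Sum>i<d. w i * of_real (x i))) (exp (\<Sum>i<d. (w i)\<^sup>2 / 2))"
proof -
  interpret N: product_prob_space "\<lambda>_::nat. std_normal_distribution"
    by (rule product_prob_std_normal)
  have 1: "integrable std_normal_distribution (\<lambda>x. exp (w i * of_real x))"
    and 2: "integral\<^sup>L std_normal_distribution (\<lambda>x. exp (w i * of_real x)) = exp ((w i)\<^sup>2/2)" for i
    using std_normal_complex_mgf[of "w i"] by (auto simp: has_bochner_integral_iff)
  have "integrable (stdG d) (\<lambda>x. \<Prod>i\<in>{0..<d}. exp (w i * of_real (x i)))"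
    unfolding stdG_def by (rule N.product_integrable_prod) (use 1 in auto)
  moreover have "integral\<^sup>L (stdG d) (\<lambda>x. \<Prod>i\<in>{0..<d}. exp (w i * of_real (x i))) = (\<Prod>i\<in>{0..<d}. exp ((w i)\<^sup>2/2))"
    unfolding stdG_def 2[symmetric] by (rule N.product_integral_prod) (use 1 in auto)
  ultimately show ?thesis
    by (simp add: has_bochner_integral_iff exp_sum lessThan_atLeast0)
qed

lemma stdG_mgf2:
  fixes a b :: complex
  shows "has_bochner_integral (stdG d) (\<lambda>x. exp (a * of_real (dotp d u x) + b * of_real (dotp d v x)))
    (exp ((a\<^sup>2 * of_real (dotp d u u) + b\<^sup>2 * of_real (dotp d v v)) / 2 + a * b * of_real (dotp d u v)))"
proof -
  have 1: "(\<Sum>i<d. (a * of_real (u i) + b * of_real (v i)) * of_real (x i))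
      = a * of_real (dotp d u x) + b * of_real (dotp d v x)" for x
    by (simp add: dotp_def sum_distrib_left algebra_simps sum.distrib)
  have 2: "(\<Sum>i<d. (a * of_real (u i) + b * of_real (v i))\<^sup>2 / 2)
    = (a\<^sup>2 * of_real (dotp d u u) + b\<^sup>2 * of_real (dotp d v v)) / 2 + a * b * of_real (dotp d u v)"
    by (simp add: dotp_def sum_distrib_left sum_divide_distrib sum.distrib[symmetric] power2_eq_square field_simps)
  show ?thesis
    using stdG_complex_mgf[of d "\<lambda>i. a * of_real (u i) + b * of_real (v i)"] unfolding 1 2 .
qed

text \<open>The absolute value sees only real parts, so this is the same Gaussian integral with real
  coefficients. It supplies the integrability that Fubini's theorem requires.\<close>

lemma stdG_norm_exp:
  fixes a b c :: complex
  assumes u: "dotp d u u = 1" and v: "dotp d v v = 1"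
  shows "has_bochner_integral (stdG d)
    (\<lambda>x. norm (exp (a * of_real (dotp d u x) + b * of_real (dotp d v x) + c)))
    (exp (((Re a)\<^sup>2 + (Re b)\<^sup>2) / 2 + Re a * Re b * dotp d u v + Re c))"
proof -
  have "has_bochner_integral (stdG d)
    (\<lambda>x. Re (exp (of_real (Re a) * of_real (dotp d u x) + of_real (Re b) * of_real (dotp d v x))))
    (Re (exp (((of_real (Re a))\<^sup>2 * of_real (dotp d u u) + (of_real (Re b))\<^sup>2 * of_real (dotp d v v)) / 2
       + of_real (Re a) * of_real (Re b) * of_real (dotp d u v))))"
    by (rule has_bochner_integral_bounded_linear[OF bounded_linear_Re stdG_mgf2])
  then have "has_bochner_integral (stdG d)
    (\<lambda>x. exp (Re a * dotp d u x + Re b * dotp d v x))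
    (exp (((Re a)\<^sup>2 + (Re b)\<^sup>2) / 2 + Re a * Re b * dotp d u v))"
    using u v by (simp add: Re_exp power2_eq_square)
  then have "has_bochner_integral (stdG d)
    (\<lambda>x. exp (Re a * dotp d u x + Re b * dotp d v x) * exp (Re c))
    (exp (((Re a)\<^sup>2 + (Re b)\<^sup>2) / 2 + Re a * Re b * dotp d u v) * exp (Re c))"
    by (intro has_bochner_integral_mult_left) auto
  then show ?thesis
    by (simp only: norm_exp_eq_Re exp_add[symmetric]) simp
qed

lemma stdG_complex_mgf_affine:
  fixes a b c :: complex
  assumes u: "dotp d u u = 1" and v: "dotp d v v = 1"
  shows "has_bochner_integral (stdG d)
    (\<lambda>x. exp (a * of_real (dotp d u x) + b * of_real (dotp d v x) + c))
    (exp ((a\<^sup>2 + b\<^sup>2) / 2 + a * b * of_real (dotp d u v) + c))"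
proof -
  have "has_bochner_integral (stdG d)
    (\<lambda>x. exp (a * of_real (dotp d u x) + b * of_real (dotp d v x)) * exp c)
    (exp ((a\<^sup>2 * of_real (dotp d u u) + b\<^sup>2 * of_real (dotp d v v)) / 2 + a * b * of_real (dotp d u v)) * exp c)"
    by (intro has_bochner_integral_mult_left stdG_mgf2)
  then show ?thesis using u v by (simp add: exp_add)
qed

text \<open>Fubini: integrate over the Gaussian first. Hypothesis \<open>int\<close> says that the
  absolute values, integrated over \<open>x\<close>, are integrable in \<open>p\<close>. It serves a
  single \<open>\<theta>\<close> as well as a pair of independent copies.\<close>

lemma stdG_integral_exp_family:
  fixes a b c :: "'p \<Rightarrow> complex"
  assumes N: "sigma_finite_measure N"
    and [measurable]: "a \<in> borel_measurable N" "b \<in> borel_measurable N" "c \<in> borel_measurable N"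
    and u: "dotp d u u = 1" and v: "dotp d v v = 1"
    and int: "integrable N (\<lambda>p. exp (((Re (a p))\<^sup>2 + (Re (b p))\<^sup>2) / 2 + Re (a p) * Re (b p) * dotp d u v + Re (c p)))"
  shows "has_bochner_integral (stdG d)
     (\<lambda>x. \<integral>p. exp (a p * of_real (dotp d u x) + b p * of_real (dotp d v x) + c p) \<partial>N)
     (\<integral>p. exp (((a p)\<^sup>2 + (b p)\<^sup>2) / 2 + a p * b p * of_real (dotp d u v) + c p) \<partial>N)"
proof -
  interpret N: sigma_finite_measure N by fact
  interpret G: prob_space "stdG d" by (rule prob_space_stdG)
  interpret P: pair_sigma_finite N "stdG d" ..
  let ?F = "\<lambda>(p, x). exp (a p * of_real (dotp d u x) + b p * of_real (dotp d v x) + c p)"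
  have m: "?F \<in> borel_measurable (N \<Otimes>\<^sub>M stdG d)" by measurable
  have I: "integrable (N \<Otimes>\<^sub>M stdG d) ?F"
  proof (rule P.Fubini_integrable[OF m])
    show "integrable N (\<lambda>p. \<integral>x. norm (?F (p, x)) \<partial>stdG d)"
      using int by (simp only: prod.case has_bochner_integral_integral_eq[OF stdG_norm_exp[OF u v]])
    show "AE p in N. integrable (stdG d) (\<lambda>x. ?F (p, x))"
      using stdG_complex_mgf_affine[OF u v] unfolding has_bochner_integral_iff by simp
  qed
  have "integrable (stdG d) (\<lambda>x. \<integral>p. ?F (p, x) \<partial>N)"
    using P.integrable_snd[of "\<lambda>p x. ?F (p, x)"] I by simp
  moreover have "(\<integral>x. (\<integral>p. ?F (p, x) \<partial>N) \<partial>stdG d) = (\<integral>p. (\<integral>x. ?F (p, x) \<partial>stdG d) \<partial>N)"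
    using P.Fubini_integral[of "\<lambda>p x. ?F (p, x)"] I by simp
  moreover have "\<dots> = (\<integral>p. exp (((a p)\<^sup>2 + (b p)\<^sup>2) / 2 + a p * b p * of_real (dotp d u v) + c p) \<partial>N)"
    by (simp only: prod.case has_bochner_integral_integral_eq[OF stdG_complex_mgf_affine[OF u v]])
  ultimately show ?thesis by (simp add: has_bochner_integral_iff)
qed

section \<open>Exponential mixtures and the correlation of their likelihood ratios\<close>

lemma (in pair_sigma_finite) has_bochner_integral_product:
  fixes f :: "'a \<Rightarrow> 'c::{real_normed_field, banach, second_countable_topology}" and g :: "'b \<Rightarrow> 'c"
  assumes f: "integrable M1 f" and g: "integrable M2 g"
  shows "has_bochner_integral (M1 \<Otimes>\<^sub>M M2) (\<lambda>p. f (fst p) * g (snd p)) (integral\<^sup>L M1 f * integral\<^sup>L M2 g)"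
proof -
  have [measurable]: "f \<in> borel_measurable M1" "g \<in> borel_measurable M2" using f g by auto
  have I: "integrable (M1 \<Otimes>\<^sub>M M2) (\<lambda>p. f (fst p) * g (snd p))"
  proof (rule Fubini_integrable)
    show "(\<lambda>p. f (fst p) * g (snd p)) \<in> borel_measurable (M1 \<Otimes>\<^sub>M M2)" by measurable
  qed (use f g in \<open>auto simp: norm_mult\<close>)
  then show ?thesis
    using integral_fst'[OF I] f g by (simp add: has_bochner_integral_iff)
qed

text \<open>\<open>q\<close> is the likelihood ratio against the standard normal law of a mixture whose components
  are encoded by \<open>\<theta>\<close>; imaginary parts of \<open>\<theta>\<close> encode variances below 1.\<close>
locale exp_mixture = prob_space M for M :: "'w measure" +
  fixes \<theta> :: "'w \<Rightarrow> complex" and q :: "real \<Rightarrow> real"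
  assumes theta_measurable [measurable]: "\<theta> \<in> borel_measurable M"
    and integrable_exp_square: "integrable M (\<lambda>w. exp ((norm (\<theta> w))\<^sup>2))"
    and q_eq: "of_real (q y) = (\<integral>w. exp (\<theta> w * of_real y - (\<theta> w)\<^sup>2 / 2) \<partial>M)"
begin

text \<open>The size of \<open>\<theta>\<close>, and with it \<open>eps\<close>, enters the
  correlation bounds only through this number. It dominates the kernel, the low moments and the
  Taylor remainder.\<close>

definition \<Gamma> :: real where "\<Gamma> = (\<integral>w. exp ((norm (\<theta> w))\<^sup>2) \<partial>M)"

lemma integrable_kernel: "integrable M (\<lambda>w. exp (\<theta> w * of_real y - (\<theta> w)\<^sup>2 / 2))"
proof (rule Bochner_Integration.integrable_bound)
  show "integrable M (\<lambda>w. exp (y\<^sup>2 / 2) * exp ((norm (\<theta> w))\<^sup>2))"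
    using integrable_exp_square by simp
  show "AE w in M. norm (exp (\<theta> w * of_real y - (\<theta> w)\<^sup>2 / 2)) \<le> norm (exp (y\<^sup>2 / 2) * exp ((norm (\<theta> w))\<^sup>2))"
  proof (rule AE_I2)
    fix w
    \<comment> \<open>This sum of squares is twice the difference of the two exponents compared
      next.\<close>
    have "0 \<le> (Re (\<theta> w) - y)\<^sup>2 + (Im (\<theta> w))\<^sup>2 + 2 * (Re (\<theta> w))\<^sup>2" by simp
    then have "Re (\<theta> w * of_real y - (\<theta> w)\<^sup>2 / 2) \<le> y\<^sup>2 / 2 + (norm (\<theta> w))\<^sup>2"
      unfolding cmod_power2 by (simp add: Re_power2 power2_eq_square field_simps)
    then show "norm (exp (\<theta> w * of_real y - (\<theta> w)\<^sup>2 / 2)) \<le> norm (exp (y\<^sup>2 / 2) * exp ((norm (\<theta> w))\<^sup>2))"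
      by (simp add: norm_exp_eq_Re flip: exp_add)
  qed
qed measurable

lemma integral_q:
  assumes v: "dotp d v v = 1"
  shows "has_bochner_integral (stdG d) (\<lambda>x. q (dotp d v x)) 1"
proof -
  \<comment> \<open>The second coefficient is 0 here, and the Gaussian integral contributes exactly
    the \<open>(\<theta> w)\<^sup>2 / 2\<close> that the kernel subtracts.\<close>
  have "has_bochner_integral (stdG d)
     (\<lambda>x. \<integral>w. exp (\<theta> w * of_real (dotp d v x) + 0 * of_real (dotp d v x) + - (\<theta> w)\<^sup>2 / 2) \<partial>M)
     (\<integral>w. exp (((\<theta> w)\<^sup>2 + 0\<^sup>2) / 2 + \<theta> w * 0 * of_real (dotp d v v) + - (\<theta> w)\<^sup>2 / 2) \<partial>M)"
  proof (rule stdG_integral_exp_family[OF _ _ _ _ v v])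
    show "sigma_finite_measure M" ..
    show "integrable M (\<lambda>p. exp (((Re (\<theta> p))\<^sup>2 + (Re 0)\<^sup>2) / 2 + Re (\<theta> p) * Re 0 * dotp d v v + Re (- (\<theta> p)\<^sup>2 / 2)))"
    proof (rule Bochner_Integration.integrable_bound[OF integrable_exp_square])
      show "AE w in M. norm (exp (((Re (\<theta> w))\<^sup>2 + (Re 0)\<^sup>2) / 2 + Re (\<theta> w) * Re 0 * dotp d v v + Re (- (\<theta> w)\<^sup>2 / 2)))
         \<le> norm (exp ((norm (\<theta> w))\<^sup>2))"
        unfolding cmod_power2 by (rule AE_I2) (simp add: Re_power2 field_simps)
    qed measurable
  qed measurable
  then have "has_bochner_integral (stdG d) (\<lambda>x. complex_of_real (q (dotp d v x))) 1"
    by (simp add: q_eq prob_space)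
  from has_bochner_integral_bounded_linear[OF bounded_linear_Re this]
  show ?thesis by simp
qed

text \<open>A product of two ratios is an integral over two independent copies of
  \<open>\<theta>\<close>. Integrating out the Gaussian produces both squares and a cross term; the
  squares cancel against the normalisation of the kernels. This is Mehler's formula without Hermite
  polynomials.\<close>

lemma correlation:
  assumes u: "dotp d u u = 1" and v: "dotp d v v = 1" and r: "\<bar>dotp d u v\<bar> \<le> 1"
  shows "integrable (stdG d) (\<lambda>x. q (dotp d u x) * q (dotp d v x))"
    and "of_real (\<integral>x. q (dotp d u x) * q (dotp d v x) \<partial>stdG d)
      = (\<integral>p. exp (of_real (dotp d u v) * (\<theta> (fst p) * \<theta> (snd p))) \<partial>(M \<Otimes>\<^sub>M M))"
proof -
  interpret P: pair_prob_space M M ..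
  have prod: "has_bochner_integral (M \<Otimes>\<^sub>M M) (\<lambda>p. exp (\<theta> (fst p) * of_real y - (\<theta> (fst p))\<^sup>2 / 2) * exp (\<theta> (snd p) * of_real z - (\<theta> (snd p))\<^sup>2 / 2))
     (of_real (q y) * of_real (q z))" for y z
    unfolding q_eq by (rule P.has_bochner_integral_product[OF integrable_kernel integrable_kernel])
  let ?c = "\<lambda>p. - (\<theta> (fst p))\<^sup>2 / 2 - (\<theta> (snd p))\<^sup>2 / 2"
  have I: "has_bochner_integral (stdG d)
     (\<lambda>x. \<integral>p. exp (\<theta> (fst p) * of_real (dotp d u x) + \<theta> (snd p) * of_real (dotp d v x) + ?c p) \<partial>(M \<Otimes>\<^sub>M M))
     (\<integral>p. exp (((\<theta> (fst p))\<^sup>2 + (\<theta> (snd p))\<^sup>2) / 2 + \<theta> (fst p) * \<theta> (snd p) * of_real (dotp d u v) + ?c p) \<partial>(M \<Otimes>\<^sub>M M))"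
  proof (rule stdG_integral_exp_family[OF _ _ _ _ u v])
    show "sigma_finite_measure (M \<Otimes>\<^sub>M M)" ..
    show "integrable (M \<Otimes>\<^sub>M M) (\<lambda>p. exp (((Re (\<theta> (fst p)))\<^sup>2 + (Re (\<theta> (snd p)))\<^sup>2) / 2
        + Re (\<theta> (fst p)) * Re (\<theta> (snd p)) * dotp d u v + Re (?c p)))"
    proof (rule Bochner_Integration.integrable_bound)
      show "integrable (M \<Otimes>\<^sub>M M) (\<lambda>p. exp ((norm (\<theta> (fst p)))\<^sup>2) * exp ((norm (\<theta> (snd p)))\<^sup>2))"
        using P.has_bochner_integral_product[OF integrable_exp_square integrable_exp_square]
        by (simp add: has_bochner_integral_iff)
      show "AE p in M \<Otimes>\<^sub>M M. norm (exp (((Re (\<theta> (fst p)))\<^sup>2 + (Re (\<theta> (snd p)))\<^sup>2) / 2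
        + Re (\<theta> (fst p)) * Re (\<theta> (snd p)) * dotp d u v + Re (?c p)))
         \<le> norm (exp ((norm (\<theta> (fst p)))\<^sup>2) * exp ((norm (\<theta> (snd p)))\<^sup>2))"
      proof (rule AE_I2)
        fix p :: "'w \<times> 'w"
        define a b where "a = \<theta> (fst p)" and "b = \<theta> (snd p)"
        have "Re a * Re b * dotp d u v \<le> \<bar>Re a * Re b\<bar> * \<bar>dotp d u v\<bar>"
          by (metis abs_ge_self abs_mult)
        also have "\<dots> \<le> \<bar>Re a\<bar> * \<bar>Re b\<bar>" using r by (simp add: mult_left_le abs_mult)
        also have "\<dots> \<le> ((Re a)\<^sup>2 + (Re b)\<^sup>2) / 2"
          using sum_squares_bound[of "\<bar>Re a\<bar>" "\<bar>Re b\<bar>"] by simp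
        finally have "((Re a)\<^sup>2 + (Re b)\<^sup>2) / 2 + Re a * Re b * dotp d u v + Re (- a\<^sup>2 / 2 - b\<^sup>2 / 2)
          \<le> (norm a)\<^sup>2 + (norm b)\<^sup>2"
          unfolding cmod_power2 using zero_le_power2[of "Im a"] zero_le_power2[of "Im b"]
            zero_le_power2[of "Re a"] zero_le_power2[of "Re b"]
          by (simp add: Re_power2 diff_divide_distrib add_divide_distrib, linarith)
        then show "norm (exp (((Re (\<theta> (fst p)))\<^sup>2 + (Re (\<theta> (snd p)))\<^sup>2) / 2
        + Re (\<theta> (fst p)) * Re (\<theta> (snd p)) * dotp d u v + Re (?c p)))
         \<le> norm (exp ((norm (\<theta> (fst p)))\<^sup>2) * exp ((norm (\<theta> (snd p)))\<^sup>2))"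
          by (simp add: a_def b_def flip: exp_add)
      qed
    qed measurable
  qed measurable
  have J: "(\<integral>p. exp (\<theta> (fst p) * of_real (dotp d u x) + \<theta> (snd p) * of_real (dotp d v x) + ?c p) \<partial>(M \<Otimes>\<^sub>M M))
      = of_real (q (dotp d u x) * q (dotp d v x))" for x
    using has_bochner_integral_integral_eq[OF prod[of "dotp d u x" "dotp d v x"]]
    by (simp add: algebra_simps flip: exp_add)
  have K: "((\<theta> (fst p))\<^sup>2 + (\<theta> (snd p))\<^sup>2) / 2 + \<theta> (fst p) * \<theta> (snd p) * of_real (dotp d u v) + ?c p
    = of_real (dotp d u v) * (\<theta> (fst p) * \<theta> (snd p))" for p
    by (simp add: field_simps)
  have *: "has_bochner_integral (stdG d) (\<lambda>x. complex_of_real (q (dotp d u x) * q (dotp d v x)))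
    (\<integral>p. exp (of_real (dotp d u v) * (\<theta> (fst p) * \<theta> (snd p))) \<partial>(M \<Otimes>\<^sub>M M))"
    using I unfolding J K .
  from has_bochner_integral_bounded_linear[OF bounded_linear_Re *]
  show "integrable (stdG d) (\<lambda>x. q (dotp d u x) * q (dotp d v x))"
    by (simp add: has_bochner_integral_iff)
  show "of_real (\<integral>x. q (dotp d u x) * q (dotp d v x) \<partial>stdG d)
      = (\<integral>p. exp (of_real (dotp d u v) * (\<theta> (fst p) * \<theta> (snd p))) \<partial>(M \<Otimes>\<^sub>M M))"
    using has_bochner_integral_integral_eq[OF *] by (simp only: integral_complex_of_real)
qed

end

text \<open>The quadratic term of the exponential series at \<open>x\<^sup>2 / 2\<close> is
  \<open>x ^ 4 / 8\<close>.\<close>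

lemma power4_le_exp:
  fixes x :: real
  shows "x ^ 4 \<le> 8 * exp (x\<^sup>2 / 2)"
  using exp_lower_Taylor_quadratic[of "x\<^sup>2 / 2"]
  by (simp add: power_divide flip: power_mult) (use zero_le_power2[of x] in linarith)

text \<open>Expanding the kernel of \<open>q\<close> in Hermite polynomials shows that the integral
  of \<open>\<theta> ^ j\<close> is the \<open>j\<close>-th Hermite moment. The assumption therefore
  says that the first three moments agree with those of a standard normal variable.\<close>

locale matched_exp_mixture = exp_mixture +
  assumes moments: "j \<in> {1, 2, 3} \<Longrightarrow> (\<integral>w. \<theta> w ^ j \<partial>M) = 0"
begin

lemma integrable_power:
  assumes "j \<le> 3"
  shows "integrable M (\<lambda>w. \<theta> w ^ j)"
proof (rule Bochner_Integration.integrable_bound)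
  show "integrable M (\<lambda>w. 3 * exp ((norm (\<theta> w))\<^sup>2))"
    using integrable_exp_square by simp
  show "AE w in M. norm (\<theta> w ^ j) \<le> norm (3 * exp ((norm (\<theta> w))\<^sup>2))"
  proof (rule AE_I2)
    fix w
    define x where "x = norm (\<theta> w)"
    have x: "0 \<le> x" by (simp add: x_def)
    have e: "1 + x\<^sup>2 + x ^ 4 / 2 \<le> exp (x\<^sup>2)"
      using exp_lower_Taylor_quadratic[of "x\<^sup>2"] by (simp flip: power_mult)
    have "x \<le> 1 + x\<^sup>2" using zero_le_power2[of "x - 1"] x
      unfolding power2_diff by simp
    moreover have "0 \<le> x\<^sup>2 * ((x - 1)\<^sup>2 + x)" using x by simp
    then have "x ^ 3 \<le> x\<^sup>2 + x ^ 4"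
      by (simp add: power2_eq_square power3_eq_cube power4_eq_xxxx algebra_simps)
    moreover have "0 \<le> x\<^sup>2" "0 \<le> x ^ 4" by auto
    ultimately have "1 \<le> 3 * exp (x\<^sup>2)" "x \<le> 3 * exp (x\<^sup>2)"
      "x\<^sup>2 \<le> 3 * exp (x\<^sup>2)" "x ^ 3 \<le> 3 * exp (x\<^sup>2)"
      using e by linarith+
    moreover have "j = 0 \<or> j = 1 \<or> j = 2 \<or> j = 3" using assms by auto
    ultimately have "x ^ j \<le> 3 * exp (x\<^sup>2)" by (elim disjE) simp_all
    then show "norm (\<theta> w ^ j) \<le> norm (3 * exp ((norm (\<theta> w))\<^sup>2))"
      by (simp add: norm_power x_def)
  qed
qed measurable

text \<open>Subtract the cubic Taylor polynomial of \<open>exp\<close>. By independence its term of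
  degree \<open>k\<close> integrates to a multiple of the squared \<open>k\<close>-th moment of
  \<open>\<theta>\<close>, so only the constant 1 survives, and it is removed by centring the
  ratios. The remainder is of fourth order in \<open>\<rho>\<close>. The case \<open>u = v\<close>
  is included and later bounds the diagonal.\<close>

lemma correlation_le:
  assumes u: "dotp d u u = 1" and v: "dotp d v v = 1" and r: "\<bar>dotp d u v\<bar> \<le> 1"
  shows "integrable (stdG d) (\<lambda>x. (q (dotp d u x) - 1) * (q (dotp d v x) - 1))"
    and "\<bar>\<integral>x. (q (dotp d u x) - 1) * (q (dotp d v x) - 1) \<partial>stdG d\<bar> \<le> 11 * dotp d u v ^ 4 * \<Gamma>\<^sup>2"
proof -
  interpret G: prob_space "stdG d" by (rule prob_space_stdG)
  interpret P: pair_prob_space M M ..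
  define \<rho> where "\<rho> = dotp d u v"
  define R where "R z = exp z - (\<Sum>k\<le>3. z ^ k / fact k)" for z :: complex
  note qu = integral_q[OF u, unfolded has_bochner_integral_iff]
  note qv = integral_q[OF v, unfolded has_bochner_integral_iff]
  note c = correlation[OF u v r, folded \<rho>_def]
  have expand: "(\<lambda>x. (q (dotp d u x) - 1) * (q (dotp d v x) - 1))
     = (\<lambda>x. q (dotp d u x) * q (dotp d v x) - q (dotp d u x) - q (dotp d v x) + 1)"
    by (auto simp: algebra_simps)
  show "integrable (stdG d) (\<lambda>x. (q (dotp d u x) - 1) * (q (dotp d v x) - 1))"
    unfolding expand using qu qv c(1) by simp
  have eq: "(\<integral>x. (q (dotp d u x) - 1) * (q (dotp d v x) - 1) \<partial>stdG d)
     = (\<integral>x. q (dotp d u x) * q (dotp d v x) \<partial>stdG d) - 1"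
    unfolding expand using qu qv c(1) by (simp add: G.prob_space)
  have bound: "norm (R (of_real \<rho> * (\<theta> (fst p) * \<theta> (snd p))))
     \<le> 11 * \<rho> ^ 4 * (exp ((norm (\<theta> (fst p)))\<^sup>2) * exp ((norm (\<theta> (snd p)))\<^sup>2))" for p
  proof -
    define a b z where "a = norm (\<theta> (fst p))" and "b = norm (\<theta> (snd p))"
      and "z = of_real \<rho> * (\<theta> (fst p) * \<theta> (snd p))"
    have ab: "0 \<le> a" "0 \<le> b" by (auto simp: a_def b_def)
    have nz: "norm z = \<bar>\<rho>\<bar> * (a * b)" by (simp add: z_def a_def b_def norm_mult)
    have "norm z \<le> a * b" unfolding nz using r ab by (simp add: \<rho>_def mult_left_le_one_le)
    also have "\<dots> \<le> a\<^sup>2 / 2 + b\<^sup>2 / 2" using sum_squares_bound[of a b] by simp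
    \<comment> \<open>Half of the exponent available in the square of \<open>\<Gamma>\<close> is
      spent here, the other half on the fourth powers by \<open>power4_le_exp\<close>. The constant
      is \<open>8 * 8 / 6\<close>, rounded up to 11.\<close>
    finally have e: "exp \<bar>Re z\<bar> \<le> exp (a\<^sup>2 / 2) * exp (b\<^sup>2 / 2)"
      using abs_Re_le_cmod[of z] by (simp flip: exp_add)
    have "norm (R z) \<le> exp \<bar>Re z\<bar> * norm z ^ Suc 3 / fact 3"
      unfolding R_def by (rule Taylor_exp)
    also have "\<dots> = exp \<bar>Re z\<bar> * (\<rho> ^ 4 * (a ^ 4 * b ^ 4)) / 6"
      by (simp add: nz power_mult_distrib fact_numeral power_even_abs)
    also have "\<dots> \<le> (exp (a\<^sup>2 / 2) * exp (b\<^sup>2 / 2)) * (\<rho> ^ 4 * ((8 * exp (a\<^sup>2 / 2)) * (8 * exp (b\<^sup>2 / 2)))) / 6"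
      by (intro divide_right_mono mult_mono e power4_le_exp) auto
    also have "\<dots> = 64 / 6 * \<rho> ^ 4 * (exp (a\<^sup>2) * exp (b\<^sup>2))"
    proof -
      have "exp (x\<^sup>2 / 2) * exp (x\<^sup>2 / 2) = exp (x\<^sup>2)" for x :: real by (simp flip: exp_add)
      from this[of a, symmetric] this[of b, symmetric] show ?thesis by simp
    qed
    also have "\<dots> \<le> 11 * \<rho> ^ 4 * (exp (a\<^sup>2) * exp (b\<^sup>2))"
      by (intro mult_right_mono) auto
    finally show ?thesis by (simp add: a_def b_def z_def)
  qed
  have dom: "has_bochner_integral (M \<Otimes>\<^sub>M M)
      (\<lambda>p. exp ((norm (\<theta> (fst p)))\<^sup>2) * exp ((norm (\<theta> (snd p)))\<^sup>2)) (\<Gamma> * \<Gamma>)"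
    unfolding \<Gamma>_def by (rule P.has_bochner_integral_product[OF integrable_exp_square integrable_exp_square])
  then have dom': "has_bochner_integral (M \<Otimes>\<^sub>M M)
      (\<lambda>p. 11 * \<rho> ^ 4 * (exp ((norm (\<theta> (fst p)))\<^sup>2) * exp ((norm (\<theta> (snd p)))\<^sup>2))) (11 * \<rho> ^ 4 * \<Gamma>\<^sup>2)"
    by (simp add: has_bochner_integral_mult_right power2_eq_square)
  have [measurable]: "R \<in> borel_measurable borel"
    unfolding R_def by measurable
  have IR: "integrable (M \<Otimes>\<^sub>M M) (\<lambda>p. R (of_real \<rho> * (\<theta> (fst p) * \<theta> (snd p))))"
  proof (rule Bochner_Integration.integrable_bound)
    show "integrable (M \<Otimes>\<^sub>M M) (\<lambda>p. 11 * \<rho> ^ 4 * (exp ((norm (\<theta> (fst p)))\<^sup>2) * exp ((norm (\<theta> (snd p)))\<^sup>2)))"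
      using dom' by (simp add: has_bochner_integral_iff)
  qed (use bound in \<open>auto intro: order_trans\<close>)
  have pw: "has_bochner_integral (M \<Otimes>\<^sub>M M) (\<lambda>p. (of_real \<rho> * (\<theta> (fst p) * \<theta> (snd p))) ^ k / fact k)
      (of_real \<rho> ^ k / fact k * ((\<integral>w. \<theta> w ^ k \<partial>M) * (\<integral>w. \<theta> w ^ k \<partial>M)))" if "k \<le> 3" for k
  proof -
    have "has_bochner_integral (M \<Otimes>\<^sub>M M) (\<lambda>p. of_real \<rho> ^ k / fact k * (\<theta> (fst p) ^ k * \<theta> (snd p) ^ k))
      (of_real \<rho> ^ k / fact k * ((\<integral>w. \<theta> w ^ k \<partial>M) * (\<integral>w. \<theta> w ^ k \<partial>M)))"
      by (intro has_bochner_integral_mult_right P.has_bochner_integral_product integrable_power that)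
    then show ?thesis by (simp add: power_mult_distrib)
  qed
  have sum: "has_bochner_integral (M \<Otimes>\<^sub>M M) (\<lambda>p. \<Sum>k\<le>3. (of_real \<rho> * (\<theta> (fst p) * \<theta> (snd p))) ^ k / fact k) 1"
  proof -
    have "has_bochner_integral (M \<Otimes>\<^sub>M M) (\<lambda>p. \<Sum>k\<le>3. (of_real \<rho> * (\<theta> (fst p) * \<theta> (snd p))) ^ k / fact k)
      (\<Sum>k\<le>(3::nat). of_real \<rho> ^ k / fact k * ((\<integral>w. \<theta> w ^ k \<partial>M) * (\<integral>w. \<theta> w ^ k \<partial>M)))"
      by (intro has_bochner_integral_sum pw) auto
    also have "(\<Sum>k\<le>(3::nat). of_real \<rho> ^ k / fact k * ((\<integral>w. \<theta> w ^ k \<partial>M) * (\<integral>w. \<theta> w ^ k \<partial>M)))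
      = (\<Sum>k\<in>{0::nat}. 1)"
    proof (rule sum.mono_neutral_cong_right)
      show "\<forall>k\<in>{..3} - {0}. of_real \<rho> ^ k / fact k * ((\<integral>w. \<theta> w ^ k \<partial>M) * (\<integral>w. \<theta> w ^ k \<partial>M)) = 0"
      proof
        fix k :: nat assume "k \<in> {..3} - {0}"
        then have "k \<in> {1, 2, 3}" by auto
        then show "of_real \<rho> ^ k / fact k * ((\<integral>w. \<theta> w ^ k \<partial>M) * (\<integral>w. \<theta> w ^ k \<partial>M)) = 0"
          using moments[of k] by simp
      qed
    qed (auto simp: prob_space)
    finally show ?thesis by simp
  qed
  have "(\<integral>p. exp (of_real \<rho> * (\<theta> (fst p) * \<theta> (snd p))) \<partial>(M \<Otimes>\<^sub>M M))
     = (\<integral>p. R (of_real \<rho> * (\<theta> (fst p) * \<theta> (snd p)))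
         + (\<Sum>k\<le>3. (of_real \<rho> * (\<theta> (fst p) * \<theta> (snd p))) ^ k / fact k) \<partial>(M \<Otimes>\<^sub>M M))"
    by (simp add: R_def)
  also have "\<dots> = (\<integral>p. R (of_real \<rho> * (\<theta> (fst p) * \<theta> (snd p))) \<partial>(M \<Otimes>\<^sub>M M)) + 1"
    using IR sum unfolding has_bochner_integral_iff by (subst Bochner_Integration.integral_add) auto
  finally have "complex_of_real ((\<integral>x. q (dotp d u x) * q (dotp d v x) \<partial>stdG d) - 1)
    = (\<integral>p. R (of_real \<rho> * (\<theta> (fst p) * \<theta> (snd p))) \<partial>(M \<Otimes>\<^sub>M M))"
    using c(2) by (simp add: algebra_simps)
  then have "\<bar>(\<integral>x. q (dotp d u x) * q (dotp d v x) \<partial>stdG d) - 1\<bar>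
    = norm (\<integral>p. R (of_real \<rho> * (\<theta> (fst p) * \<theta> (snd p))) \<partial>(M \<Otimes>\<^sub>M M))"
    by (metis norm_of_real)
  also have "\<dots> \<le> (\<integral>p. norm (R (of_real \<rho> * (\<theta> (fst p) * \<theta> (snd p)))) \<partial>(M \<Otimes>\<^sub>M M))"
    by (rule integral_norm_bound)
  also have "\<dots> \<le> (\<integral>p. 11 * \<rho> ^ 4 * (exp ((norm (\<theta> (fst p)))\<^sup>2) * exp ((norm (\<theta> (snd p)))\<^sup>2)) \<partial>(M \<Otimes>\<^sub>M M))"
    using IR dom' bound by (intro integral_mono) (auto simp: has_bochner_integral_iff)
  also have "\<dots> = 11 * \<rho> ^ 4 * \<Gamma>\<^sup>2"
    using dom' by (simp add: has_bochner_integral_iff)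
  finally show "\<bar>\<integral>x. (q (dotp d u x) - 1) * (q (dotp d v x) - 1) \<partial>stdG d\<bar> \<le> 11 * dotp d u v ^ 4 * \<Gamma>\<^sup>2"
    unfolding eq \<rho>_def .
qed

end

section \<open>Mixtures of Gaussian likelihood ratios\<close>

text \<open>The density of a normal law with mean \<open>a\<close> and variance
  \<open>1 - b\<^sup>2\<close> divided by the standard normal density, written as a shift by
  \<open>a\<close> times a correction of the variance.\<close>

definition gauss_ratio :: "real \<Rightarrow> real \<Rightarrow> real \<Rightarrow> real" where
  "gauss_ratio a b y = exp (a * y - a\<^sup>2 / 2 - b\<^sup>2 * (y - a)\<^sup>2 / (2 * (1 - b\<^sup>2))) / sqrt (1 - b\<^sup>2)"

lemma gauss_ratio_nonneg: "b\<^sup>2 \<le> 1 \<Longrightarrow> 0 \<le> gauss_ratio a b y"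
  by (simp add: gauss_ratio_def)

lemma gauss_ratio_measurable [measurable]: "gauss_ratio a b \<in> borel_measurable borel"
  unfolding gauss_ratio_def by measurable

text \<open>With \<open>\<theta> = a + \<i> b z\<close> the exponent is
  \<open>a y - a\<^sup>2 / 2\<close> plus \<open>\<i> b (y - a) z + b\<^sup>2 z\<^sup>2 / 2\<close>,
  an instance of \<open>std_normal_quadratic\<close>.\<close>

lemma gauss_ratio_eq:
  assumes b: "b\<^sup>2 < 1"
  shows "has_bochner_integral std_normal_distribution
    (\<lambda>z. exp (Complex a (b * z) * of_real y - (Complex a (b * z))\<^sup>2 / 2)) (of_real (gauss_ratio a b y))"
proof -
  have "has_bochner_integral std_normal_distribution
     (\<lambda>z. of_real (exp (a * y - a\<^sup>2 / 2)) * exp (\<i> * of_real ((b * (y - a)) * z) + of_real (b\<^sup>2 * z\<^sup>2 / 2)))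
     (of_real (exp (a * y - a\<^sup>2 / 2)) * complex_of_real (exp (- (b * (y - a))\<^sup>2 / (2 * (1 - b\<^sup>2))) / sqrt (1 - b\<^sup>2)))"
    by (intro has_bochner_integral_mult_right std_normal_quadratic b)
  also have "(\<lambda>z. of_real (exp (a * y - a\<^sup>2 / 2)) * exp (\<i> * of_real ((b * (y - a)) * z) + of_real (b\<^sup>2 * z\<^sup>2 / 2)))
    = (\<lambda>z. exp (Complex a (b * z) * of_real y - (Complex a (b * z))\<^sup>2 / 2))"
    unfolding exp_of_real[symmetric] exp_add[symmetric]
    by (intro ext arg_cong[where f=exp]) (simp add: complex_eq_iff power2_eq_square field_simps)
  also have "of_real (exp (a * y - a\<^sup>2 / 2)) * complex_of_real (exp (- (b * (y - a))\<^sup>2 / (2 * (1 - b\<^sup>2))) / sqrt (1 - b\<^sup>2))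
    = of_real (gauss_ratio a b y)"
    unfolding gauss_ratio_def of_real_mult[symmetric]
    by (rule arg_cong[where f=of_real]) (simp add: power_mult_distrib flip: exp_add)
  finally show ?thesis .
qed

lemma std_normal_moments:
  "has_bochner_integral std_normal_distribution (\<lambda>x. x) 0"
  "has_bochner_integral std_normal_distribution (\<lambda>x. x\<^sup>2) 1"
  "has_bochner_integral std_normal_distribution (\<lambda>x. x ^ 3) 0"
  using integrable_std_normal_distribution_moment[of 1] integrable_std_normal_distribution_moment[of 2]
    integrable_std_normal_distribution_moment[of 3]
    integral_std_normal_distribution_moment_odd[of 1] integral_std_normal_distribution_moment_odd[of 3]
    std_normal_distribution_even_moments(1)[of 1]
  by (auto simp: has_bochner_integral_iff)

lemma complex_gauss_moments:
  "has_bochner_integral std_normal_distribution (\<lambda>z. Complex a (b * z)) (of_real a)"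
  "has_bochner_integral std_normal_distribution (\<lambda>z. (Complex a (b * z))\<^sup>2) (of_real (a\<^sup>2 - b\<^sup>2))"
  "has_bochner_integral std_normal_distribution (\<lambda>z. (Complex a (b * z)) ^ 3) (of_real (a ^ 3 - 3 * a * b\<^sup>2))"
proof -
  interpret real_distribution std_normal_distribution by (rule real_dist_normal_dist)
  have const: "has_bochner_integral std_normal_distribution (\<lambda>z. c) c" for c :: complex
    using prob_space by (simp add: has_bochner_integral_iff)
  have m: "has_bochner_integral std_normal_distribution (\<lambda>x. complex_of_real x) (of_real 0)"
    "has_bochner_integral std_normal_distribution (\<lambda>x. complex_of_real (x\<^sup>2)) (of_real 1)"
    "has_bochner_integral std_normal_distribution (\<lambda>x. complex_of_real (x ^ 3)) (of_real 0)"
    by (intro has_bochner_integral_of_real std_normal_moments)+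
  have C: "Complex a (b * z) = of_real a + \<i> * of_real b * of_real z" for z
    by (simp add: complex_eq_iff)
  have "has_bochner_integral std_normal_distribution (\<lambda>z. of_real a + \<i> * of_real b * of_real z)
    (of_real a + \<i> * of_real b * of_real 0)"
    by (intro has_bochner_integral_add const has_bochner_integral_mult_right m)
  then show "has_bochner_integral std_normal_distribution (\<lambda>z. Complex a (b * z)) (of_real a)"
    by (simp add: C)
  have "has_bochner_integral std_normal_distribution
     (\<lambda>z. of_real (a\<^sup>2) + (2 * \<i> * of_real (a * b) * of_real z + of_real (- b\<^sup>2) * of_real (z\<^sup>2)))
     (of_real (a\<^sup>2) + (2 * \<i> * of_real (a * b) * of_real 0 + of_real (- b\<^sup>2) * of_real 1))"
    by (intro has_bochner_integral_add const has_bochner_integral_mult_right m)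
  also have "(\<lambda>z. of_real (a\<^sup>2) + (2 * \<i> * of_real (a * b) * of_real z + of_real (- b\<^sup>2) * of_real (z\<^sup>2)))
     = (\<lambda>z. (Complex a (b * z))\<^sup>2)"
    by (auto simp: complex_eq_iff power2_eq_square)
  finally show "has_bochner_integral std_normal_distribution (\<lambda>z. (Complex a (b * z))\<^sup>2) (of_real (a\<^sup>2 - b\<^sup>2))"
    by simp
  have "has_bochner_integral std_normal_distribution
     (\<lambda>z. of_real (a ^ 3) + (3 * \<i> * of_real (a\<^sup>2 * b) * of_real z + (of_real (- 3 * a * b\<^sup>2) * of_real (z\<^sup>2)
        + - \<i> * of_real (b ^ 3) * of_real (z ^ 3))))
     (of_real (a ^ 3) + (3 * \<i> * of_real (a\<^sup>2 * b) * of_real 0 + (of_real (- 3 * a * b\<^sup>2) * of_real 1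
        + - \<i> * of_real (b ^ 3) * of_real 0)))"
    by (intro has_bochner_integral_add const has_bochner_integral_mult_right m)
  also have "(\<lambda>z. of_real (a ^ 3) + (3 * \<i> * of_real (a\<^sup>2 * b) * of_real z + (of_real (- 3 * a * b\<^sup>2) * of_real (z\<^sup>2)
        + - \<i> * of_real (b ^ 3) * of_real (z ^ 3)))) = (\<lambda>z. (Complex a (b * z)) ^ 3)"
    by (auto simp: complex_eq_iff power2_eq_square power3_eq_cube algebra_simps)
  finally show "has_bochner_integral std_normal_distribution (\<lambda>z. (Complex a (b * z)) ^ 3) (of_real (a ^ 3 - 3 * a * b\<^sup>2))"
    by simp
qed

text \<open>Here the variance of a component has to exceed 1/2, since otherwise
  \<open>exp (b\<^sup>2 * z\<^sup>2)\<close> is not integrable. The clean part has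
  \<open>b\<^sup>2 = 1 / 3\<close>.\<close>

lemma complex_gauss_exp_square:
  assumes "b\<^sup>2 < 1 / 2"
  shows "has_bochner_integral std_normal_distribution (\<lambda>z. exp ((norm (Complex a (b * z)))\<^sup>2))
    (exp (a\<^sup>2) / sqrt (1 - 2 * b\<^sup>2))"
proof -
  have "has_bochner_integral std_normal_distribution
     (\<lambda>x. Re (exp (\<i> * of_real (0 * x) + of_real (2 * b\<^sup>2 * x\<^sup>2 / 2))))
     (Re (complex_of_real (exp (- 0\<^sup>2 / (2 * (1 - 2 * b\<^sup>2))) / sqrt (1 - 2 * b\<^sup>2))))"
    by (intro has_bochner_integral_bounded_linear[OF bounded_linear_Re] std_normal_quadratic) (use assms in simp)
  then have "has_bochner_integral std_normal_distribution (\<lambda>x. exp (b\<^sup>2 * x\<^sup>2)) (1 / sqrt (1 - 2 * b\<^sup>2))"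
    by (simp add: Re_exp)
  then have "has_bochner_integral std_normal_distribution (\<lambda>x. exp (a\<^sup>2) * exp (b\<^sup>2 * x\<^sup>2))
     (exp (a\<^sup>2) * (1 / sqrt (1 - 2 * b\<^sup>2)))"
    by (rule has_bochner_integral_mult_right)
  then show ?thesis by (simp add: cmod_power2 power_mult_distrib flip: exp_add)
qed

text \<open>The first coordinate selects a component of the mixture, the second is the normal
  variable in the imaginary part of \<open>\<theta>\<close>.\<close>

definition mix_space :: "nat set \<Rightarrow> (nat \<Rightarrow> real) \<Rightarrow> (nat \<times> real) measure" where
  "mix_space J w = point_measure J w \<Otimes>\<^sub>M std_normal_distribution"

lemma mix_space_integral:
  fixes f :: "nat \<times> real \<Rightarrow> 'a::{banach, second_countable_topology}"
  assumes J: "finite J" and w: "\<And>j. j \<in> J \<Longrightarrow> 0 \<le> w j" "(\<Sum>j\<in>J. w j) = 1"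
    and f: "\<And>j. j \<in> J \<Longrightarrow> has_bochner_integral std_normal_distribution (\<lambda>z. f (j, z)) (c j)"
  shows "f \<in> borel_measurable (mix_space J w)"
    and "has_bochner_integral (mix_space J w) f (\<Sum>j\<in>J. w j *\<^sub>R c j)"
    and "prob_space (mix_space J w)"
proof -
  interpret N: real_distribution std_normal_distribution by (rule real_dist_normal_dist)
  interpret W: prob_space "point_measure J w"
    by (rule prob_spaceI) (use J w in \<open>auto simp: emeasure_point_measure_finite space_point_measure sum_ennreal\<close>)
  interpret P: pair_prob_space "point_measure J w" std_normal_distribution ..
  show "prob_space (mix_space J w)" 
    unfolding mix_space_def by (rule P.P.prob_space_axioms)
  have "f \<in> borel_measurable (count_space J \<Otimes>\<^sub>M std_normal_distribution)"
    by (rule measurable_pair_measure_countable1)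
      (use J f in \<open>auto intro: countable_finite dest: borel_measurable_has_bochner_integral\<close>)
  also have "borel_measurable (count_space J \<Otimes>\<^sub>M std_normal_distribution)
     = borel_measurable (point_measure J w \<Otimes>\<^sub>M std_normal_distribution)"
    by (intro measurable_cong_sets sets_pair_measure_cong) (auto simp: sets_point_measure)
  finally have m: "f \<in> borel_measurable (point_measure J w \<Otimes>\<^sub>M std_normal_distribution)" .
  then show "f \<in> borel_measurable (mix_space J w)" by (simp add: mix_space_def)
  have I: "integrable (point_measure J w \<Otimes>\<^sub>M std_normal_distribution) f"
  proof (rule P.Fubini_integrable[OF m])
    show "integrable (point_measure J w) (\<lambda>x. \<integral>y. norm (f (x, y)) \<partial>std_normal_distribution)"
      by (rule integrable_point_measure_finite[OF J])
    show "AE x in point_measure J w. integrable std_normal_distribution (\<lambda>y. f (x, y))"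
      using f by (intro AE_I2) (auto simp: space_point_measure has_bochner_integral_iff)
  qed
  have "integral\<^sup>L (point_measure J w \<Otimes>\<^sub>M std_normal_distribution) f = (\<Sum>j\<in>J. w j *\<^sub>R c j)"
    using f w unfolding P.integral_fst'[OF I, symmetric]
    by (subst lebesgue_integral_point_measure_finite[OF J])
      (auto simp: has_bochner_integral_iff intro!: sum.cong)
  then show "has_bochner_integral (mix_space J w) f (\<Sum>j\<in>J. w j *\<^sub>R c j)"
    using I by (simp add: has_bochner_integral_iff mix_space_def)
qed

text \<open>Turns moment matching into the polynomial equations \<open>m1\<close>,
  \<open>m2\<close>, \<open>m3\<close>, whose summands are the weighted moments from
  \<open>complex_gauss_moments\<close>.\<close>

lemma matched_exp_mixture_mix_space:
  assumes J: "finite J" and w: "\<And>j. j \<in> J \<Longrightarrow> 0 \<le> w j" "(\<Sum>j\<in>J. w j) = 1"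
    and b: "\<And>j. j \<in> J \<Longrightarrow> (b j)\<^sup>2 < 1 / 2"
    and m1: "(\<Sum>j\<in>J. w j * a j) = 0" and m2: "(\<Sum>j\<in>J. w j * ((a j)\<^sup>2 - (b j)\<^sup>2)) = 0"
    and m3: "(\<Sum>j\<in>J. w j * ((a j) ^ 3 - 3 * a j * (b j)\<^sup>2)) = 0"
  shows "matched_exp_mixture (mix_space J w) (\<lambda>p. Complex (a (fst p)) (b (fst p) * snd p))
     (\<lambda>y. \<Sum>j\<in>J. w j * gauss_ratio (a j) (b j) y)"
    and "exp_mixture.\<Gamma> (mix_space J w) (\<lambda>p. Complex (a (fst p)) (b (fst p) * snd p))
      = (\<Sum>j\<in>J. w j * (exp ((a j)\<^sup>2) / sqrt (1 - 2 * (b j)\<^sup>2)))"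
proof -
  let ?th = "\<lambda>p. Complex (a (fst p)) (b (fst p) * snd p)"
  have g: "has_bochner_integral (mix_space J w) (\<lambda>p. exp ((norm (?th p))\<^sup>2))
     (\<Sum>j\<in>J. w j *\<^sub>R (exp ((a j)\<^sup>2) / sqrt (1 - 2 * (b j)\<^sup>2)))"
    by (rule mix_space_integral[OF J w]) (use complex_gauss_exp_square b in auto)
  have mom1: "has_bochner_integral (mix_space J w) ?th (\<Sum>j\<in>J. w j *\<^sub>R of_real (a j))"
    and meas: "?th \<in> borel_measurable (mix_space J w)"
    and prob: "prob_space (mix_space J w)"
    using mix_space_integral[OF J w, of ?th "\<lambda>j. of_real (a j)"] complex_gauss_moments(1) by simp_all
  have mom2: "has_bochner_integral (mix_space J w) (\<lambda>p. (?th p)\<^sup>2) (\<Sum>j\<in>J. w j *\<^sub>R of_real ((a j)\<^sup>2 - (b j)\<^sup>2))"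
    by (rule mix_space_integral[OF J w]) (use complex_gauss_moments(2) in simp_all)
  have mom3: "has_bochner_integral (mix_space J w) (\<lambda>p. (?th p) ^ 3)
      (\<Sum>j\<in>J. w j *\<^sub>R of_real ((a j) ^ 3 - 3 * a j * (b j)\<^sup>2))"
    by (rule mix_space_integral[OF J w]) (use complex_gauss_moments(3) in simp_all)
  have q: "has_bochner_integral (mix_space J w) (\<lambda>p. exp (?th p * of_real y - (?th p)\<^sup>2 / 2))
      (\<Sum>j\<in>J. w j *\<^sub>R of_real (gauss_ratio (a j) (b j) y))" for y
  proof (rule mix_space_integral[OF J w])
    fix j assume "j \<in> J"
    then have "(b j)\<^sup>2 < 1" using b[of j] by simp
    from gauss_ratio_eq[OF this] show "has_bochner_integral std_normal_distribution
       (\<lambda>z. exp (?th (j, z) * of_real y - (?th (j, z))\<^sup>2 / 2)) (of_real (gauss_ratio (a j) (b j) y))"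
      by simp
  qed
  have real: "(\<Sum>j\<in>J. w j *\<^sub>R complex_of_real (f j)) = of_real (\<Sum>j\<in>J. w j * f j)" for f
    by (simp add: scaleR_conv_of_real)
  have ms: "(\<integral>p. ?th p ^ 1 \<partial>mix_space J w) = 0" "(\<integral>p. ?th p ^ 2 \<partial>mix_space J w) = 0"
    "(\<integral>p. ?th p ^ 3 \<partial>mix_space J w) = 0"
    using mom1 mom2 mom3 unfolding real m1 m2 m3 by (simp_all add: has_bochner_integral_iff)
  have E: "exp_mixture (mix_space J w) ?th (\<lambda>y. \<Sum>j\<in>J. w j * gauss_ratio (a j) (b j) y)"
    using prob meas g q unfolding exp_mixture_def exp_mixture_axioms_def real
    by (simp add: has_bochner_integral_iff)
  then show "matched_exp_mixture (mix_space J w) ?th (\<lambda>y. \<Sum>j\<in>J. w j * gauss_ratio (a j) (b j) y)"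
    using ms by (auto simp: matched_exp_mixture_def matched_exp_mixture_axioms_def)
  show "exp_mixture.\<Gamma> (mix_space J w) ?th = (\<Sum>j\<in>J. w j * (exp ((a j)\<^sup>2) / sqrt (1 - 2 * (b j)\<^sup>2)))"
    using g unfolding exp_mixture.\<Gamma>_def[OF E] by (simp add: has_bochner_integral_iff)
qed

section \<open>The moment-matching noise\<close>

text \<open>\<open>\<delta>\<close> is the third central moment divided by the variance. The support
  is bounded explicitly because the squares of its points end up in the exponent of
  \<open>\<Gamma>\<close>.\<close>

lemma two_point_moments:
  fixes m s t :: real
  assumes V: "m\<^sup>2 < s"
  defines "\<delta> \<equiv> (t - 3 * m * s + 2 * m ^ 3) / (s - m\<^sup>2)"
  shows "\<exists>p x y. 0 \<le> p \<and> p \<le> 1 \<and> p * x + (1 - p) * y = m \<and> p * x\<^sup>2 + (1 - p) * y\<^sup>2 = s \<and>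
    p * x ^ 3 + (1 - p) * y ^ 3 = t \<and>
    \<bar>x\<bar> \<le> \<bar>m\<bar> + \<bar>\<delta>\<bar> + sqrt (s - m\<^sup>2) \<and> \<bar>y\<bar> \<le> \<bar>m\<bar> + \<bar>\<delta>\<bar> + sqrt (s - m\<^sup>2)"
proof -
  \<comment> \<open>The points are \<open>m + a\<close> and \<open>m - b\<close>, where \<open>a * b\<close> is the variance and \<open>a - b = \<delta>\<close>.\<close>
  define V where "V = s - m\<^sup>2"
  define D where "D = sqrt (\<delta>\<^sup>2 + 4 * V)"
  have V: "V > 0" using V by (simp add: V_def)
  have D2: "D\<^sup>2 = \<delta>\<^sup>2 + 4 * V" using V by (simp add: D_def)
  have D\<delta>: "\<bar>\<delta>\<bar> < D" unfolding D_def using V by (intro real_less_rsqrt) simp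
  then have D0: "D > 0" by linarith
  have DV: "D \<le> \<bar>\<delta>\<bar> + 2 * sqrt V"
    unfolding D_def using sqrt_add_le_add_sqrt[of "\<delta>\<^sup>2" "4 * V"] V by (simp add: real_sqrt_mult)
  define a b p where "a = (D + \<delta>) / 2" and "b = (D - \<delta>) / 2" and "p = b / D"
  have ab: "a > 0" "b > 0" "a + b = D" "a - b = \<delta>" using D\<delta> by (auto simp: a_def b_def field_simps)
  have abV: "a * b = V"
    using D2 by (simp add: a_def b_def power2_eq_square algebra_simps)
  have p: "p * D = b" "(1 - p) * D = a" using D0 ab(3) by (auto simp: p_def field_simps)
  have p01: "0 \<le> p" "p \<le> 1" using ab D0 by (auto simp: p_def)
  \<comment> \<open>Since \<open>p\<close> is a quotient by \<open>D\<close>, each central moment is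
    verified after multiplication by \<open>D\<close>.\<close>
  have cancel: "x = y" if "x * D = y * D" for x y using that D0 by simp
  have "(p * a - (1 - p) * b) * D = (p * D) * a - ((1 - p) * D) * b" by (simp add: algebra_simps)
  also have "\<dots> = 0 * D" unfolding p by simp
  finally have c1: "p * a - (1 - p) * b = 0" by (rule cancel)
  have "(p * a\<^sup>2 + (1 - p) * b\<^sup>2) * D = (p * D) * a\<^sup>2 + ((1 - p) * D) * b\<^sup>2" by (simp add: algebra_simps)
  also have "\<dots> = V * D" unfolding p unfolding abV[symmetric] ab(3)[symmetric] by (simp add: power2_eq_square algebra_simps)
  finally have c2: "p * a\<^sup>2 + (1 - p) * b\<^sup>2 = V" by (rule cancel)
  have "(p * a ^ 3 - (1 - p) * b ^ 3) * D = (p * D) * a ^ 3 - ((1 - p) * D) * b ^ 3" by (simp add: algebra_simps)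
  also have "\<dots> = V * \<delta> * D" unfolding p unfolding abV[symmetric] ab(3,4)[symmetric]
    by (simp add: power3_eq_cube algebra_simps)
  finally have c3: "p * a ^ 3 - (1 - p) * b ^ 3 = V * \<delta>" by (rule cancel)
  have \<delta>V: "V * \<delta> = t - 3 * m * s + 2 * m ^ 3" using V by (simp add: \<delta>_def V_def)
  have e1: "p * (m + a) + (1 - p) * (m - b) = m" using c1 by algebra
  have e2: "p * (m + a)\<^sup>2 + (1 - p) * (m - b)\<^sup>2 = s" using c1 c2 V_def by algebra
  have e3: "p * (m + a) ^ 3 + (1 - p) * (m - b) ^ 3 = t" using c1 c2 c3 \<delta>V V_def by algebra
  have "\<bar>m + a\<bar> \<le> \<bar>m\<bar> + \<bar>\<delta>\<bar> + sqrt V" "\<bar>m - b\<bar> \<le> \<bar>m\<bar> + \<bar>\<delta>\<bar> + sqrt V"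
    using DV ab unfolding a_def b_def by (auto simp: field_simps abs_if split: if_splits)
  then show ?thesis using p01 e1 e2 e3 unfolding V_def by blast
qed

text \<open>The equations balance the first three moments of \<open>\<theta>\<close>; the clean part
  has \<open>b\<^sup>2 = 1 / 3\<close>, so its third moment is \<open>mu ^ 3 - mu\<close>. They
  prescribe the moments \<open>m\<close>, \<open>s2\<close>, \<open>t3\<close> of a two-point law.
  Its mean, \<open>\<delta>\<close> and standard deviation are each at most
  \<open>1 / sqrt eps\<close>, hence the 9.\<close>

lemma noise_moments:
  fixes eps :: real
  assumes eps: "0 < eps" "eps < 1 / 2"
  defines "mu \<equiv> c1 * sqrt eps"
  shows "\<exists>p x y. 0 \<le> p \<and> p \<le> 1 \<and> (1 - eps) * mu + eps * (p * x + (1 - p) * y) = 0 \<and>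
    (1 - eps) * (mu\<^sup>2 - 1 / 3) + eps * (p * x\<^sup>2 + (1 - p) * y\<^sup>2) = 0 \<and>
    (1 - eps) * (mu ^ 3 - mu) + eps * (p * x ^ 3 + (1 - p) * y ^ 3) = 0 \<and>
    x\<^sup>2 \<le> 9 / eps \<and> y\<^sup>2 \<le> 9 / eps"
proof -
  define s where "s = sqrt eps"
  have s: "s > 0" "s\<^sup>2 = eps" using eps by (auto simp: s_def)
  define r where "r = (1 - eps) / eps"
  have r: "r > 0" "r * eps = 1 - eps" "1 + r = 1 / eps" using eps by (auto simp: r_def field_simps)
  have c: "0 < c1" "c1 \<le> 1/100" "c1\<^sup>2 \<le> 1/100" by (auto simp: c1_def power2_eq_square)
  have mu: "mu = c1 * s" "mu\<^sup>2 = c1\<^sup>2 * eps" "mu > 0"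
    using s c by (auto simp: mu_def s_def power_mult_distrib)
  define m s2 t3 where "m = - r * mu" and "s2 = r * (1/3 - mu\<^sup>2)" and "t3 = r * (mu - mu ^ 3)"
  \<comment> \<open>The scaling of the mean pays off here:
    \<open>mu\<^sup>2 * (1 + r) = mu\<^sup>2 / eps = c1\<^sup>2\<close>, so the variance is positive
    uniformly in \<open>eps\<close>.\<close>
  have V: "s2 - m\<^sup>2 = r * (1/3 - c1\<^sup>2)"
    unfolding s2_def m_def using mu(2) r(2) by algebra
  have V0: "r * (1/3 - c1\<^sup>2) > 0" using r c by simp
  \<comment> \<open>The third central moment is \<open>r * mu * K\<close>. The factor
    \<open>r\<close> cancels against the variance, and \<open>K\<close> is at most
    \<open>1 + r = 1 / eps\<close>, so \<open>\<delta>\<close> is of order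
    \<open>c1 / sqrt eps\<close>.\<close>
  define K where "K = 1 + r - (mu\<^sup>2 + 3 * (r * mu\<^sup>2) + 2 * (r * (r * mu\<^sup>2)))"
  have kap: "t3 - 3 * m * s2 + 2 * m ^ 3 = r * (mu * K)"
    unfolding t3_def m_def s2_def K_def by algebra
  have m1: "mu\<^sup>2 \<le> c1\<^sup>2" using eps unfolding mu(2) by (simp add: mult_left_le)
  have "r * mu\<^sup>2 = c1\<^sup>2 * (1 - eps)" using mu(2) r(2) by algebra
  then have m2: "r * mu\<^sup>2 \<le> c1\<^sup>2" "0 \<le> r * mu\<^sup>2" using eps r by (auto simp: mult_left_le)
  have m3: "r * (r * mu\<^sup>2) \<le> r * (1/100)" "0 \<le> r * (r * mu\<^sup>2)"
    using m2 c r by (auto intro!: mult_left_mono)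
  have K: "0 \<le> K" "K \<le> 1 / eps"
    using m1 m2 m3 r c zero_le_power2[of mu] unfolding K_def by linarith+
  define \<delta> where "\<delta> = (t3 - 3 * m * s2 + 2 * m ^ 3) / (s2 - m\<^sup>2)"
  have "\<delta> = mu * K / (1/3 - c1\<^sup>2)" unfolding \<delta>_def kap V using r by simp
  also have "\<dots> \<le> mu * (1 / eps) / (1/4)"
    using K mu(3) c eps by (intro frac_le mult_left_mono mult_nonneg_nonneg) auto
  also have "\<dots> = 4 * c1 / s" using s by (simp add: mu(1) flip: s(2)) (simp add: power2_eq_square)
  finally have d1: "\<delta> \<le> 4 * c1 / s" .
  have d0: "0 \<le> \<delta>" using \<open>\<delta> = mu * K / (1/3 - c1\<^sup>2)\<close> K mu c by simp
  have "4 * c1 / s \<le> 1 / s" using s c by (intro divide_right_mono) auto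
  then have d: "\<bar>\<delta>\<bar> \<le> 1 / s" using d0 d1 by linarith
  have "\<bar>m\<bar> = r * mu" using r mu(3) by (simp only: m_def abs_mult abs_minus_cancel abs_of_pos)
  also have "\<dots> \<le> (1 / eps) * mu" using r(3) mu by (intro mult_right_mono) auto
  also have "\<dots> = c1 / s" using s by (simp add: mu(1) flip: s(2)) (simp add: power2_eq_square)
  also have "\<dots> \<le> 1 / s" using s c by (intro divide_right_mono) auto
  finally have m: "\<bar>m\<bar> \<le> 1 / s" .
  have "1/3 - c1\<^sup>2 \<le> 1" using zero_le_power2[of c1] by linarith
  then have "r * (1/3 - c1\<^sup>2) \<le> r * 1" using r by (intro mult_left_mono) auto
  also have "\<dots> \<le> 1 / eps" using r(3) by simp
  also have "\<dots> = (1 / s)\<^sup>2" by (simp add: power_divide s)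
  finally have v: "sqrt (s2 - m\<^sup>2) \<le> 1 / s" using s unfolding V by (intro real_le_lsqrt) auto
  have "m\<^sup>2 < s2" using V V0 by linarith
  from two_point_moments[OF this, of t3, folded \<delta>_def]
  obtain p x y where p: "0 \<le> p" "p \<le> 1" "p * x + (1 - p) * y = m" "p * x\<^sup>2 + (1 - p) * y\<^sup>2 = s2"
    "p * x ^ 3 + (1 - p) * y ^ 3 = t3"
    and b: "\<bar>x\<bar> \<le> \<bar>m\<bar> + \<bar>\<delta>\<bar> + sqrt (s2 - m\<^sup>2)" "\<bar>y\<bar> \<le> \<bar>m\<bar> + \<bar>\<delta>\<bar> + sqrt (s2 - m\<^sup>2)"
    by blast
  have "\<bar>x\<bar> \<le> 3 * (1 / s)" "\<bar>y\<bar> \<le> 3 * (1 / s)" using b m d v by linarith+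
  then have "\<bar>x\<bar>\<^sup>2 \<le> (3 * (1 / s))\<^sup>2" "\<bar>y\<bar>\<^sup>2 \<le> (3 * (1 / s))\<^sup>2" by (intro power_mono; simp)+
  then have "x\<^sup>2 \<le> 9 / eps" "y\<^sup>2 \<le> 9 / eps" by (simp_all add: power_mult_distrib power_divide s)
  moreover have "(1 - eps) * mu + eps * m = 0" "(1 - eps) * (mu\<^sup>2 - 1 / 3) + eps * s2 = 0"
    "(1 - eps) * (mu ^ 3 - mu) + eps * t3 = 0"
    unfolding m_def s2_def t3_def using r(2) by algebra+
  ultimately show ?thesis using p by (metis (no_types))
qed

section \<open>Contaminated Gaussians as densities against the standard Gaussian\<close>

lemma unit_vec_dotp: "unit_vec d v \<Longrightarrow> dotp d v v = 1"
  by (simp add: unit_vec_def l2norm_def dotp_def power2_eq_square)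

text \<open>The inverse covariance is the identity plus \<open>v v^T / 2\<close> and the determinant
  is 2/3, so the exponent differs from the standard one only through \<open>dotp d v x\<close>. The
  variance 2/3 along \<open>v\<close> is \<open>1 - b\<^sup>2\<close> for
  \<open>b = 1 / sqrt 3\<close>.\<close>

lemma mvnormal_eq_density_stdG:
  assumes v: "unit_vec d v"
  shows "mvnormal d (\<lambda>i. m * v i) (\<lambda>i j. (if i = j then 1 else 0) - (1/3) * v i * v j)
    = density (stdG d) (\<lambda>x. ennreal (gauss_ratio m (1 / sqrt 3) (dotp d v x)))"
proof -
  let ?S = "\<lambda>i j. (if i = j then 1 else 0) - (1/3) * v i * v j"
  have vv: "(\<Sum>i<d. v i * v i) = 1" using unit_vec_dotp[OF v] by (simp add: dotp_def)
  have det: "det_d d ?S = 2 / 3"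
  proof -
    have "det_d d ?S = det_d d (\<lambda>i j. (if i = j then 1 else 0) + (- (1/3) * v i) * v j)" by simp
    also have "\<dots> = 1 + (\<Sum>i<d. (- (1/3) * v i) * v i)" by (rule det_d_rank_one)
    also have "\<dots> = 1 - 1/3 * (\<Sum>i<d. v i * v i)" by (simp add: sum_distrib_left sum_negf)
    finally show ?thesis using vv by simp
  qed
  have "gaussian_density d (\<lambda>i. m * v i) ?S x
     = (\<Prod>i<d. std_normal_density (x i)) * gauss_ratio m (1 / sqrt 3) (dotp d v x)" for x
  proof -
    define y where "y = dotp d v x"
    define z where "z i = x i - m * v i" for i
    have "(\<Sum>i<d. \<Sum>j<d. z i * inv_d d ?S i j * z j)
      = (\<Sum>i<d. \<Sum>j<d. (if j = i then z i * z i else 0) + (1/2) * ((v i * z i) * (v j * z j)))"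
    proof (intro sum.cong refl)
      fix i j assume "i \<in> {..<d}" "j \<in> {..<d}"
      then have "i < d" "j < d" by auto
      from inv_d_rank_one[OF vv this]
      have I: "inv_d d ?S i j = (if i = j then 1 else 0) + (1/2) * v i * v j" .
      show "z i * inv_d d ?S i j * z j = (if j = i then z i * z i else 0) + (1/2) * ((v i * z i) * (v j * z j))"
        unfolding I by (simp add: algebra_simps)
    qed
    also have "\<dots> = (\<Sum>i<d. z i * z i) + (1/2) * ((\<Sum>i<d. v i * z i) * (\<Sum>j<d. v j * z j))"
      unfolding sum.distrib sum_product sum_distrib_left[symmetric] by simp
    also have "(\<Sum>i<d. v i * z i) = y - m"
    proof -
      have "(\<Sum>i<d. v i * z i) = (\<Sum>i<d. v i * x i) - m * (\<Sum>i<d. v i * v i)"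
        by (simp add: z_def sum_distrib_left sum_subtractf algebra_simps)
      then show ?thesis by (simp add: vv y_def dotp_def)
    qed
    also have "(\<Sum>i<d. z i * z i) = (\<Sum>i<d. (x i)\<^sup>2) - 2 * m * y + m\<^sup>2"
    proof -
      have "(\<Sum>i<d. z i * z i) = (\<Sum>i<d. (x i)\<^sup>2) - 2 * m * (\<Sum>i<d. v i * x i) + m\<^sup>2 * (\<Sum>i<d. v i * v i)"
        by (simp add: z_def sum_distrib_left sum_subtractf sum.distrib algebra_simps power2_eq_square)
      then show ?thesis by (simp add: vv y_def dotp_def)
    qed
    finally have quad: "(\<Sum>i<d. \<Sum>j<d. z i * inv_d d ?S i j * z j)
       = (\<Sum>i<d. (x i)\<^sup>2) - 2 * m * y + m\<^sup>2 + (1/2) * ((y - m) * (y - m))" .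
    have e: "- (1/2) * ((\<Sum>i<d. (x i)\<^sup>2) - 2 * m * y + m\<^sup>2 + (1/2) * ((y - m) * (y - m)))
       = - (\<Sum>i<d. (x i)\<^sup>2) / 2 + (m * y - m\<^sup>2 / 2 - (1 / sqrt 3)\<^sup>2 * (y - m)\<^sup>2 / (2 * (1 - (1 / sqrt 3)\<^sup>2)))"
      by (simp add: power_divide power2_eq_square field_simps)
    have f: "(\<Prod>i<d. std_normal_density (x i)) = exp (- (\<Sum>i<d. (x i)\<^sup>2) / 2) / sqrt ((2 * pi) ^ d)"
      unfolding real_sqrt_power
      by (simp add: std_normal_density_def prod_dividef exp_sum[symmetric] sum_negf sum_divide_distrib
          power_one_over prod.distrib del: real_sqrt_mult power_mult_distrib)
    have g: "(1 / sqrt 3)\<^sup>2 = (1/3 :: real)" by (simp add: power_divide)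
    show ?thesis
      unfolding gaussian_density_def z_def[symmetric] quad e exp_add det f gauss_ratio_def y_def[symmetric]
      by (simp add: real_sqrt_mult g real_sqrt_divide)
  qed
  then have "mvnormal d (\<lambda>i. m * v i) ?S
    = density (Rd d) (\<lambda>x. ennreal (\<Prod>i<d. std_normal_density (x i)) * ennreal (gauss_ratio m (1 / sqrt 3) (dotp d v x)))"
    unfolding mvnormal_def
    by (subst ennreal_mult[symmetric]) (auto intro!: prod_nonneg gauss_ratio_nonneg simp: power_divide)
  also have "\<dots> = density (stdG d) (\<lambda>x. ennreal (gauss_ratio m (1 / sqrt 3) (dotp d v x)))"
  proof -
    have "(\<lambda>x. ennreal (\<Prod>i<d. std_normal_density (x i))) \<in> borel_measurable (Rd d)"
      unfolding Rd_def by measurable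
    then show ?thesis unfolding stdG_eq_density by (subst density_density_eq) auto
  qed
  finally show ?thesis .
qed

text \<open>Both sides are \<open>measure_of\<close> on the same sigma-algebra, so it suffices to
  compare the set functions; countable additivity of the mixture need not be proved
  separately.\<close>

lemma mix_measure_density:
  assumes [measurable]: "p \<in> borel_measurable (stdG d)" "b \<in> borel_measurable (stdG d)"
    and nn: "\<And>x. 0 \<le> p x" "\<And>x. 0 \<le> b x" and eps: "0 \<le> eps" "eps \<le> 1"
  shows "mix_measure d eps (density (stdG d) (\<lambda>x. ennreal (p x))) (density (stdG d) (\<lambda>x. ennreal (b x)))
    = density (stdG d) (\<lambda>x. ennreal ((1 - eps) * p x + eps * b x))"
proof -
  have sp: "space (Rd d) = space (stdG d)" by (intro sets_eq_imp_space_eq) (simp add: sets_stdG)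
  show ?thesis
    unfolding mix_measure_def density_def[of "stdG d" "\<lambda>x. ennreal ((1 - eps) * p x + eps * b x)"] sp sets_stdG[symmetric]
  proof (rule measure_of_eq)
    show "sets (stdG d) \<subseteq> Pow (space (stdG d))" by (rule sets.space_closed)
    fix A assume "A \<in> sigma_sets (space (stdG d)) (sets (stdG d))"
    then have [measurable]: "A \<in> sets (stdG d)" by (simp add: sets.sigma_sets_eq)
    have "ennreal (1 - eps) * emeasure (density (stdG d) (\<lambda>x. ennreal (p x))) A
        + ennreal eps * emeasure (density (stdG d) (\<lambda>x. ennreal (b x))) A
      = (\<integral>\<^sup>+x. ennreal (1 - eps) * (ennreal (p x) * indicator A x) + ennreal eps * (ennreal (b x) * indicator A x) \<partial>stdG d)"
      by (simp add: emeasure_density nn_integral_add nn_integral_cmult)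
    also have "\<dots> = (\<integral>\<^sup>+x. ennreal ((1 - eps) * p x + eps * b x) * indicator A x \<partial>stdG d)"
      using nn eps by (intro nn_integral_cong) (auto simp: ennreal_mult ennreal_plus indicator_def)
    finally show "ennreal (1 - eps) * emeasure (density (stdG d) (\<lambda>x. ennreal (p x))) A
        + ennreal eps * emeasure (density (stdG d) (\<lambda>x. ennreal (b x))) A
      = (\<integral>\<^sup>+x. ennreal ((1 - eps) * p x + eps * b x) * indicator A x \<partial>stdG d)" .
  qed
qed

text \<open>The left side is \<open>\<Gamma>\<close> for the hard mixture;
  \<open>sqrt (1 / 3)\<close> is \<open>sqrt (1 - 2 * b\<^sup>2)\<close> for the clean
  component.\<close>

lemma exp_moment_bound:
  fixes eps p x y :: real
  assumes eps: "0 < eps" "eps < 1 / 2" and p: "0 \<le> p" "p \<le> 1"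
    and xy: "x\<^sup>2 \<le> 9 / eps" "y\<^sup>2 \<le> 9 / eps"
  shows "(1 - eps) * (exp ((c1 * sqrt eps)\<^sup>2) / sqrt (1 / 3)) + eps * (p * exp (x\<^sup>2) + (1 - p) * exp (y\<^sup>2)) \<le> exp (9 / eps)"
proof -
  have "(c1 * sqrt eps)\<^sup>2 \<le> 1" using eps by (simp add: c1_def power_mult_distrib power2_eq_square)
  then have "exp ((c1 * sqrt eps)\<^sup>2) \<le> exp 1" by simp
  moreover have "1 / sqrt (1 / 3) \<le> exp (1 :: real)"
  proof -
    have "1 / sqrt (1 / 3) = sqrt (3 :: real)" by (simp add: real_sqrt_divide)
    also have "\<dots> \<le> 2" by (rule real_le_lsqrt) auto
    also have "\<dots> \<le> exp 1" using exp_ge_add_one_self[of 1] by simp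
    finally show ?thesis .
  qed
  ultimately have "exp ((c1 * sqrt eps)\<^sup>2) * (1 / sqrt (1 / 3)) \<le> exp 1 * exp 1"
    by (intro mult_mono) auto
  also have "\<dots> = exp 2" by (simp flip: exp_add)
  also have "\<dots> \<le> exp (9 / eps)" using eps by (simp add: field_simps)
  finally have 1: "exp ((c1 * sqrt eps)\<^sup>2) / sqrt (1 / 3) \<le> exp (9 / eps)" by simp
  have "p * exp (x\<^sup>2) + (1 - p) * exp (y\<^sup>2) \<le> p * exp (9 / eps) + (1 - p) * exp (9 / eps)"
    using p xy by (intro add_mono mult_left_mono) auto
  also have "\<dots> = exp (9 / eps)" by (simp add: algebra_simps)
  finally have 2: "p * exp (x\<^sup>2) + (1 - p) * exp (y\<^sup>2) \<le> exp (9 / eps)" .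
  have "(1 - eps) * (exp ((c1 * sqrt eps)\<^sup>2) / sqrt (1 / 3)) + eps * (p * exp (x\<^sup>2) + (1 - p) * exp (y\<^sup>2))
     \<le> (1 - eps) * exp (9 / eps) + eps * exp (9 / eps)"
    using 1 2 eps by (intro add_mono mult_left_mono) auto
  then show ?thesis by (simp add: algebra_simps)
qed

lemma integral_gauss_ratio_0:
  assumes "dotp d v v = 1"
  shows "has_bochner_integral (stdG d) (\<lambda>x. gauss_ratio a 0 (dotp d v x)) 1"
  using stdG_norm_exp[OF assms assms, of "of_real a" 0 "of_real (- a\<^sup>2 / 2)"]
  by (simp add: gauss_ratio_def norm_exp_eq_Re)

text \<open>The one-dimensional data depend on \<open>eps\<close> alone. Dimension and direction
  enter only by evaluating \<open>q\<close> and \<open>b\<close> at \<open>dotp d v x\<close>, so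
  one mixture serves all hidden vectors.\<close>

lemma hard_mixture_exists:
  fixes eps :: real
  assumes eps: "0 < eps" "eps < 1 / 2"
  obtains M :: "(nat \<times> real) measure" and \<theta> q b
  where "matched_exp_mixture M \<theta> q" and "exp_mixture.\<Gamma> M \<theta> \<le> exp (9 / eps)"
    and "\<And>y. 0 \<le> q y" and "q \<in> borel_measurable borel"
    and "\<And>d v. unit_vec d v \<Longrightarrow> admissible_noise d (density (stdG d) (\<lambda>x. ennreal (b (dotp d v x))))"
    and "\<And>d v. unit_vec d v \<Longrightarrow> hard_dist d eps v (density (stdG d) (\<lambda>x. ennreal (b (dotp d v x))))
      = density (stdG d) (\<lambda>x. ennreal (q (dotp d v x)))"
proof -
  define mu where "mu = c1 * sqrt eps"
  obtain p x y where p: "0 \<le> p" "p \<le> 1"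
    and m: "(1 - eps) * mu + eps * (p * x + (1 - p) * y) = 0"
      "(1 - eps) * (mu\<^sup>2 - 1 / 3) + eps * (p * x\<^sup>2 + (1 - p) * y\<^sup>2) = 0"
      "(1 - eps) * (mu ^ 3 - mu) + eps * (p * x ^ 3 + (1 - p) * y ^ 3) = 0"
    and xy: "x\<^sup>2 \<le> 9 / eps" "y\<^sup>2 \<le> 9 / eps"
    using noise_moments[OF eps] unfolding mu_def by blast
  \<comment> \<open>Component 0 is the clean Gaussian; 1 and 2 are the two halves of the
    noise.\<close>
  define w where "w j = (if j = 0 then 1 - eps else if j = 1 then eps * p else eps * (1 - p))" for j :: nat
  define a where "a j = (if j = 0 then mu else if j = 1 then x else y)" for j :: nat
  define s where "s j = (if j = 0 then 1 / sqrt 3 else 0 :: real)" for j :: nat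
  define b where "b z = p * gauss_ratio x 0 z + (1 - p) * gauss_ratio y 0 z" for z
  define q where "q z = (1 - eps) * gauss_ratio mu (1 / sqrt 3) z + eps * b z" for z
  let ?J = "{0, 1, 2 :: nat}"
  let ?th = "\<lambda>z. Complex (a (fst z)) (s (fst z) * snd z)"
  have sq3: "(1 / sqrt 3)\<^sup>2 = (1 / 3 :: real)" by (simp add: power_divide)
  have q_sum: "q = (\<lambda>z. \<Sum>j\<in>?J. w j * gauss_ratio (a j) (s j) z)"
    by (simp add: fun_eq_iff q_def b_def w_def a_def s_def algebra_simps)
  have hyps: "finite ?J" "\<And>j. j \<in> ?J \<Longrightarrow> 0 \<le> w j" "(\<Sum>j\<in>?J. w j) = 1" "\<And>j. j \<in> ?J \<Longrightarrow> (s j)\<^sup>2 < 1 / 2"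
    "(\<Sum>j\<in>?J. w j * a j) = 0" "(\<Sum>j\<in>?J. w j * ((a j)\<^sup>2 - (s j)\<^sup>2)) = 0"
    "(\<Sum>j\<in>?J. w j * ((a j) ^ 3 - 3 * a j * (s j)\<^sup>2)) = 0"
    using eps p m by (auto simp: w_def a_def s_def sq3 algebra_simps diff_divide_distrib)
  note mix = matched_exp_mixture_mix_space[where J = ?J and w = w and a = a and b = s, OF hyps]
  have b0: "0 \<le> b z" for z unfolding b_def using p by (simp add: gauss_ratio_nonneg)
  have bm [measurable]: "b \<in> borel_measurable borel" unfolding b_def by measurable
  show ?thesis
  proof (rule that)
    show "matched_exp_mixture (mix_space ?J w) ?th q" unfolding q_sum by (rule mix(1))
    show "exp_mixture.\<Gamma> (mix_space ?J w) ?th \<le> exp (9 / eps)"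
    proof -
      have "exp_mixture.\<Gamma> (mix_space ?J w) ?th = (\<Sum>j\<in>?J. w j * (exp ((a j)\<^sup>2) / sqrt (1 - 2 * (s j)\<^sup>2)))"
        by (rule mix(2))
      also have "\<dots> = (1 - eps) * (exp ((c1 * sqrt eps)\<^sup>2) / sqrt (1 / 3)) + eps * (p * exp (x\<^sup>2) + (1 - p) * exp (y\<^sup>2))"
        by (simp add: w_def a_def s_def sq3 mu_def algebra_simps)
      finally show ?thesis using exp_moment_bound[OF eps p xy] by simp
    qed
    show "0 \<le> q z" for z
      unfolding q_def using b0 eps by (simp add: gauss_ratio_nonneg sq3)
    show "q \<in> borel_measurable borel" unfolding q_def by measurable
    fix d v assume v: "unit_vec d v"
    note vv = unit_vec_dotp[OF v]
    have "has_bochner_integral (stdG d) (\<lambda>x. b (dotp d v x)) (p * 1 + (1 - p) * 1)"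
      unfolding b_def by (intro has_bochner_integral_add has_bochner_integral_mult_right integral_gauss_ratio_0 vv)
    then have I: "has_bochner_integral (stdG d) (\<lambda>x. b (dotp d v x)) 1" by simp
    have "prob_space (density (stdG d) (\<lambda>x. ennreal (b (dotp d v x))))"
    proof (rule prob_spaceI)
      have "emeasure (density (stdG d) (\<lambda>x. ennreal (b (dotp d v x)))) (space (stdG d))
         = (\<integral>\<^sup>+x. ennreal (b (dotp d v x)) \<partial>stdG d)"
        by (subst emeasure_density) (auto intro!: nn_integral_cong)
      also have "\<dots> = 1"
        using I b0 by (subst nn_integral_eq_integral) (auto simp: has_bochner_integral_iff)
      finally show "emeasure (density (stdG d) (\<lambda>x. ennreal (b (dotp d v x))))
         (space (density (stdG d) (\<lambda>x. ennreal (b (dotp d v x))))) = 1" by simp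
    qed
    then show "admissible_noise d (density (stdG d) (\<lambda>x. ennreal (b (dotp d v x))))"
      by (simp add: admissible_noise_def sets_stdG)
    show "hard_dist d eps v (density (stdG d) (\<lambda>x. ennreal (b (dotp d v x))))
      = density (stdG d) (\<lambda>x. ennreal (q (dotp d v x)))"
      unfolding hard_dist_def mu_def[symmetric] mvnormal_eq_density_stdG[OF v] q_def
      using eps b0 by (subst mix_measure_density) (auto simp: gauss_ratio_nonneg sq3)
  qed
qed

section \<open>Statistical queries\<close>

context matched_exp_mixture
begin

lemma \<Gamma>_ge_1: "1 \<le> \<Gamma>"
proof -
  have "(\<integral>w. 1 \<partial>M) \<le> (\<integral>w. exp ((norm (\<theta> w))\<^sup>2) \<partial>M)"
    by (rule integral_mono) (use integrable_exp_square in auto)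
  then show ?thesis by (simp add: \<Gamma>_def prob_space)
qed

text \<open>Let \<open>H\<close> be the sum of the \<open>n\<close> centred ratios. Then
  \<open>n * \<tau>\<close> is at most the integral of \<open>f * H\<close>, and therefore its
  square at most that of \<open>H\<^sup>2\<close>. The latter has \<open>n\<close> diagonal terms of
  order \<open>\<Gamma>\<^sup>2\<close> and fewer than \<open>n\<^sup>2\<close> others of order
  \<open>r ^ 4 * \<Gamma>\<^sup>2\<close>. As \<open>\<tau>\<^sup>2\<close> is at least twice the
  off-diagonal bound, the diagonal must carry half of the total, which limits
  \<open>n\<close>.\<close>

lemma card_distinguished_le:
  fixes T :: "(nat \<Rightarrow> real) set" and r \<tau> :: real
  assumes T: "finite T" and unit: "\<And>v. v \<in> T \<Longrightarrow> dotp d v v = 1"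
    and corr: "\<And>u v. u \<in> T \<Longrightarrow> v \<in> T \<Longrightarrow> u \<noteq> v \<Longrightarrow> \<bar>dotp d u v\<bar> \<le> r"
    and r: "0 \<le> r" "r \<le> 1"
    and f [measurable]: "f \<in> borel_measurable (stdG d)" and f1: "\<And>x. \<bar>f x\<bar> \<le> 1"
    and dist: "\<And>v. v \<in> T \<Longrightarrow> \<tau> < (\<integral>x. f x * (q (dotp d v x) - 1) \<partial>stdG d)"
    and \<tau>: "0 < \<tau>" "22 * r ^ 4 * \<Gamma>\<^sup>2 \<le> \<tau>\<^sup>2"
  shows "card T * r ^ 4 \<le> 1"
proof (cases "T = {}")
  case False
  interpret G: prob_space "stdG d" by (rule prob_space_stdG)
  define n where "n = real (card T)"
  have n: "n > 0" using T False by (simp add: n_def card_gt_0_iff)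
  define h where "h v x = q (dotp d v x) - 1" for v x
  define H where "H x = (\<Sum>v\<in>T. h v x)" for x
  have hint: "integrable (stdG d) (h v)" if "v \<in> T" for v
    using integral_q[OF unit[OF that]] unfolding h_def has_bochner_integral_iff by simp
  have hm: "h v \<in> borel_measurable (stdG d)" if "v \<in> T" for v
    using hint[OF that] by auto
  have fh: "integrable (stdG d) (\<lambda>x. f x * h v x)" if "v \<in> T" for v
  proof (rule Bochner_Integration.integrable_bound[OF hint[OF that]])
    show "(\<lambda>x. f x * h v x) \<in> borel_measurable (stdG d)" using hm[OF that] by measurable
    show "AE x in stdG d. norm (f x * h v x) \<le> norm (h v x)"
      using f1 by (intro AE_I2) (auto simp: abs_mult mult_left_le_one_le)
  qed
  have le1: "\<bar>dotp d u v\<bar> \<le> 1" if "u \<in> T" "v \<in> T" for u v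
    using corr[OF that] unit that r by (cases "u = v") auto
  have hh: "integrable (stdG d) (\<lambda>x. h u x * h v x)"
    and hhb: "(\<integral>x. h u x * h v x \<partial>stdG d) \<le> 11 * \<Gamma>\<^sup>2 * (if u = v then 1 else 0) + 11 * r ^ 4 * \<Gamma>\<^sup>2"
    if uv: "u \<in> T" "v \<in> T" for u v
  proof -
    note c = correlation_le[OF unit[OF uv(1)] unit[OF uv(2)] le1[OF uv], folded h_def]
    show "integrable (stdG d) (\<lambda>x. h u x * h v x)" by (rule c(1))
    \<comment> \<open>One bound for diagonal and off-diagonal pairs, so that the double sum can be
      evaluated in closed form.\<close>
    have "dotp d u v ^ 4 \<le> (if u = v then 1 else 0) + r ^ 4"
    proof (cases "u = v")
      case False
      then have "\<bar>dotp d u v\<bar> ^ 4 \<le> r ^ 4" using corr[OF uv] by (intro power_mono) auto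
      then show ?thesis using False by (simp add: power_even_abs)
    qed (use unit uv in simp)
    then have "11 * dotp d u v ^ 4 * \<Gamma>\<^sup>2 \<le> 11 * ((if u = v then 1 else 0) + r ^ 4) * \<Gamma>\<^sup>2"
      by (intro mult_right_mono mult_left_mono) auto
    also have "\<dots> = 11 * \<Gamma>\<^sup>2 * (if u = v then 1 else 0) + 11 * r ^ 4 * \<Gamma>\<^sup>2"
      by (simp add: algebra_simps)
    finally show "(\<integral>x. h u x * h v x \<partial>stdG d) \<le> 11 * \<Gamma>\<^sup>2 * (if u = v then 1 else 0) + 11 * r ^ 4 * \<Gamma>\<^sup>2"
      using c(2) by linarith
  qed
  have H2: "(H x)\<^sup>2 = (\<Sum>u\<in>T. \<Sum>v\<in>T. h u x * h v x)" for x
    by (simp add: H_def power2_eq_square sum_product)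
  have H2i: "integrable (stdG d) (\<lambda>x. (H x)\<^sup>2)"
    unfolding H2 using hh by (intro Bochner_Integration.integrable_sum) auto
  have "(\<integral>x. (H x)\<^sup>2 \<partial>stdG d) = (\<Sum>u\<in>T. \<Sum>v\<in>T. \<integral>x. h u x * h v x \<partial>stdG d)"
    unfolding H2 using hh by (simp add: Bochner_Integration.integral_sum)
  also have "\<dots> \<le> (\<Sum>u\<in>T. \<Sum>v\<in>T. 11 * \<Gamma>\<^sup>2 * (if u = v then 1 else 0) + 11 * r ^ 4 * \<Gamma>\<^sup>2)"
    by (intro sum_mono hhb)
  also have "\<dots> = n * (11 * \<Gamma>\<^sup>2 + n * (11 * r ^ 4 * \<Gamma>\<^sup>2))"
  proof -
    have "(\<Sum>v\<in>T. 11 * \<Gamma>\<^sup>2 * (if u = v then 1 else 0) + 11 * r ^ 4 * \<Gamma>\<^sup>2)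
       = 11 * \<Gamma>\<^sup>2 + n * (11 * r ^ 4 * \<Gamma>\<^sup>2)" if "u \<in> T" for u
      unfolding sum.distrib sum_distrib_left[symmetric] using T that by (simp add: n_def)
    then have "(\<Sum>u\<in>T. \<Sum>v\<in>T. 11 * \<Gamma>\<^sup>2 * (if u = v then 1 else 0) + 11 * r ^ 4 * \<Gamma>\<^sup>2)
       = (\<Sum>u\<in>T. 11 * \<Gamma>\<^sup>2 + n * (11 * r ^ 4 * \<Gamma>\<^sup>2))" by (rule sum.cong[OF refl])
    then show ?thesis by (simp add: n_def)
  qed
  finally have H2b: "(\<integral>x. (H x)\<^sup>2 \<partial>stdG d) \<le> n * (11 * \<Gamma>\<^sup>2 + n * (11 * r ^ 4 * \<Gamma>\<^sup>2))" .
  \<comment> \<open>Pointwise AM-GM with weight \<open>s\<close> replaces Cauchy-Schwarz. As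
    \<open>s\<close> is also the lower bound, half of it is absorbed and \<open>s * s\<close> is at
    most the second moment of \<open>H\<close>.\<close>
  define s where "s = n * \<tau>"
  have s: "s > 0" using n \<tau> by (simp add: s_def)
  have "s = (\<Sum>v\<in>T. \<tau>)" by (simp add: s_def n_def)
  also have "\<dots> \<le> (\<Sum>v\<in>T. \<integral>x. f x * h v x \<partial>stdG d)"
    using dist by (intro sum_mono) (auto simp: h_def less_imp_le)
  also have "\<dots> = (\<integral>x. f x * H x \<partial>stdG d)"
    unfolding H_def sum_distrib_left using fh by (simp add: Bochner_Integration.integral_sum)
  also have "\<dots> \<le> (\<integral>x. s / 2 + (H x)\<^sup>2 / (2 * s) \<partial>stdG d)"
  proof (rule integral_mono)
    show "integrable (stdG d) (\<lambda>x. f x * H x)"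
      unfolding H_def sum_distrib_left using fh by auto
    show "integrable (stdG d) (\<lambda>x. s / 2 + (H x)\<^sup>2 / (2 * s))" using H2i by simp
    fix x
    have "f x * H x \<le> \<bar>H x\<bar>"
      using f1[of x] by (metis abs_ge_self abs_ge_zero abs_mult mult_left_le_one_le order_trans)
    also have "\<dots> \<le> s / 2 + (H x)\<^sup>2 / (2 * s)"
      using s sum_squares_bound[of s "\<bar>H x\<bar>"] by (simp add: field_simps power2_eq_square)
    finally show "f x * H x \<le> s / 2 + (H x)\<^sup>2 / (2 * s)" .
  qed
  also have "\<dots> = s / 2 + (\<integral>x. (H x)\<^sup>2 \<partial>stdG d) / (2 * s)"
    using H2i by (simp add: G.prob_space)
  finally have "s / 2 \<le> (\<integral>x. (H x)\<^sup>2 \<partial>stdG d) / (2 * s)" by simp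
  then have "s * s \<le> (\<integral>x. (H x)\<^sup>2 \<partial>stdG d)" using s by (simp add: field_simps)
  then have "n * (n * \<tau>\<^sup>2) \<le> n * (11 * \<Gamma>\<^sup>2 + n * (11 * r ^ 4 * \<Gamma>\<^sup>2))"
    using H2b by (simp add: s_def power2_eq_square algebra_simps)
  then have "n * \<tau>\<^sup>2 \<le> 11 * \<Gamma>\<^sup>2 + n * (11 * r ^ 4 * \<Gamma>\<^sup>2)" using n by simp
  moreover have "n * (22 * r ^ 4 * \<Gamma>\<^sup>2) \<le> n * \<tau>\<^sup>2" using \<tau> n by (intro mult_left_mono) auto
  ultimately have "(n * r ^ 4) * \<Gamma>\<^sup>2 \<le> 1 * \<Gamma>\<^sup>2" by (simp add: algebra_simps)
  then show ?thesis using \<Gamma>_ge_1 by (simp add: n_def)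
qed simp

end

section \<open>Oracle strategies and the adversary argument\<close>

lemma exists_answers: "\<exists>ans. \<forall>i. ans i = R (map ans [0..<i])"
proof -
  \<comment> \<open>An oracle strategy \<open>R\<close> depends on all earlier answers, so the
    recursion runs over histories.\<close>
  define hist where "hist = rec_nat [] (\<lambda>_ h. h @ [R h])"
  have h: "hist 0 = []" "hist (Suc i) = hist i @ [R (hist i)]" for i by (simp_all add: hist_def)
  have "hist i = map (\<lambda>i. R (hist i)) [0..<i]" for i
    by (induction i) (simp_all add: h)
  then show ?thesis by (intro exI[of _ "\<lambda>i. R (hist i)"]) metis
qed

lemma sq_outputs_unique:
  assumes "sq_outputs A ans n u" and "sq_outputs A ans n' u'"
  shows "u = u'"
proof -
  have "n = n'"
    using assms unfolding sq_outputs_def sq_queries_upto_def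
    by (metis linorder_neqE_nat sum.distinct(1))
  then show ?thesis using assms by (simp add: sq_outputs_def)
qed

text \<open>Run \<open>A\<close> on the reference answers \<open>g\<close>. Each query is bad for at
  most \<open>m\<close> vectors, so two vectors have no bad query among the first \<open>n\<close>.
  If \<open>A\<close> halted within these queries it would give both the same output, against
  \<open>sep\<close>. As \<open>min_tol\<close> concerns only tolerances met in valid runs, the run
  on \<open>g\<close> is not known to be valid beforehand and is compared with the runs
  \<open>a v\<close>, which are.\<close>

lemma sq_adversary:
  fixes A :: "real list \<Rightarrow> ('a \<Rightarrow> real) \<times> real + 'b" and D :: "'v \<Rightarrow> 'a measure"
  assumes S: "finite S" and m: "0 \<le> m" "real n * m + 2 \<le> real (card S)"
    and pos: "\<And>h f \<tau>. A h = Inl (f, \<tau>) \<Longrightarrow> 0 < \<tau>"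
    and out: "\<And>v ans. v \<in> S \<Longrightarrow> sq_valid_answers A (D v) ans \<Longrightarrow> \<exists>n u. sq_outputs A ans n u \<and> close v u"
    and sep: "\<And>u v w. v \<in> S \<Longrightarrow> w \<in> S \<Longrightarrow> close v u \<Longrightarrow> close w u \<Longrightarrow> v = w"
    and min_tol: "\<And>v ans i f \<tau>. v \<in> S \<Longrightarrow> sq_valid_answers A (D v) ans \<Longrightarrow> sq_queries_upto A ans i \<Longrightarrow>
        A (map ans [0..<i]) = Inl (f, \<tau>) \<Longrightarrow> tol < \<tau>"
    and few: "\<And>h f \<tau>. A h = Inl (f, \<tau>) \<Longrightarrow> real (card {v\<in>S. tol < \<bar>integral\<^sup>L (D v) f - e f\<bar>}) \<le> m"
  shows "\<exists>v\<in>S. \<exists>ans. sq_valid_answers A (D v) ans \<and> sq_queries_upto A ans (Suc n)"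
proof -
  obtain g where g: "\<And>i. g i = (case A (map g [0..<i]) of Inl (f, \<tau>) \<Rightarrow> e f | Inr u \<Rightarrow> 0)"
    using exists_answers[of "\<lambda>h. case A h of Inl (f, \<tau>) \<Rightarrow> e f | Inr u \<Rightarrow> 0"] by blast
  \<comment> \<open>Answer with the reference value as long as this is legal, so that the answers are valid for every \<open>v\<close>.\<close>
  define R where "R v h = (case A h of Inl (f, \<tau>) \<Rightarrow>
      (if \<bar>e f - integral\<^sup>L (D v) f\<bar> \<le> \<tau> then e f else integral\<^sup>L (D v) f) | Inr u \<Rightarrow> 0)" for v h
  have "\<forall>v. \<exists>ans. \<forall>i. ans i = R v (map ans [0..<i])" using exists_answers by blast
  then obtain a where a: "\<And>v i. a v i = R v (map (a v) [0..<i])" by metis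
  have valid: "sq_valid_answers A (D v) (a v)" for v
    unfolding sq_valid_answers_def
  proof (intro allI impI)
    fix i f \<tau> assume "A (map (a v) [0..<i]) = Inl (f, \<tau>)"
    then show "\<bar>a v i - integral\<^sup>L (D v) f\<bar> \<le> \<tau>"
      using pos[of _ f \<tau>] by (subst a) (auto simp: R_def less_imp_le)
  qed
  define Bad where "Bad i = {v\<in>S. \<exists>f \<tau>. A (map g [0..<i]) = Inl (f, \<tau>) \<and> tol < \<bar>integral\<^sup>L (D v) f - e f\<bar>}" for i
  have Bad: "real (card (Bad i)) \<le> m" for i
  proof (cases "A (map g [0..<i])")
    case (Inl p)
    obtain f \<tau> where p: "p = (f, \<tau>)" by (cases p)
    then have "Bad i = {v\<in>S. tol < \<bar>integral\<^sup>L (D v) f - e f\<bar>}" using Inl by (auto simp: Bad_def)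
    then show ?thesis using few[of _ f \<tau>] Inl p by auto
  qed (use m in \<open>simp add: Bad_def\<close>)
  have "real (card (\<Union>i<n. Bad i)) \<le> (\<Sum>i<n. real (card (Bad i)))"
    using card_UN_le[of "{..<n}" Bad] by (metis finite_lessThan of_nat_le_iff of_nat_sum)
  also have "\<dots> \<le> (\<Sum>i<n. m)" by (intro sum_mono Bad)
  finally have "real (card (\<Union>i<n. Bad i)) + 2 \<le> real (card S)" using m by simp
  then have "card (\<Union>i<n. Bad i) + 2 \<le> card S" by linarith
  moreover have "card S - card (\<Union>i<n. Bad i) \<le> card (S - (\<Union>i<n. Bad i))"
    by (rule diff_card_le_card_Diff) (auto simp: Bad_def S intro: finite_subset[OF _ S])
  ultimately have "2 \<le> card (S - (\<Union>i<n. Bad i))" by linarith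
  then obtain V where "V \<subseteq> S - (\<Union>i<n. Bad i)" "card V = 2"
    using obtain_subset_with_card_n by metis
  then obtain v w where vw: "v \<in> S - (\<Union>i<n. Bad i)" "w \<in> S - (\<Union>i<n. Bad i)" "v \<noteq> w"
    by (auto simp: card_2_iff)
  \<comment> \<open>While the histories agree, the next query occurs in the valid run
    \<open>a z\<close>, so its tolerance exceeds \<open>tol\<close>. As \<open>z\<close> is not bad
    for it, the reference value is legal and \<open>a z\<close> gives it too.\<close>
  have agree: "map (a z) [0..<i] = map g [0..<i]"
    if z: "z \<in> S - (\<Union>i<n. Bad i)" and "i \<le> n" "sq_queries_upto A g i" for z i
    using that(2,3)
  proof (induction i)
    case (Suc i)
    have q: "sq_queries_upto A g i" using Suc.prems by (simp add: sq_queries_upto_def)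
    then have IH: "map (a z) [0..<i] = map g [0..<i]" using Suc by simp
    have IHj: "map (a z) [0..<j] = map g [0..<j]" if "j \<le> i" for j
      using IH that by (auto simp: map_eq_conv)
    obtain f \<tau> where f: "A (map g [0..<i]) = Inl (f, \<tau>)"
      using Suc.prems unfolding sq_queries_upto_def by (metis lessI surj_pair)
    have "sq_queries_upto A (a z) i"
      using q IHj unfolding sq_queries_upto_def by (metis less_imp_le)
    then have "tol < \<tau>" using min_tol[of z "a z" i f \<tau>] z valid f IH by simp
    moreover have "\<not> tol < \<bar>integral\<^sup>L (D z) f - e f\<bar>"
      using z Suc.prems f unfolding Bad_def by (auto simp: Suc_le_eq)
    ultimately have "a z i = g i"
      using f by (subst a, subst g) (auto simp: IH R_def abs_minus_commute)
    then show ?case using IH by simp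
  qed simp
  show ?thesis
  proof (cases "sq_queries_upto A g (Suc n)")
    case True
    then have "sq_queries_upto A g n" by (simp add: sq_queries_upto_def)
    then have ag: "map (a v) [0..<n] = map g [0..<n]" using agree vw by blast
    then have "map (a v) [0..<i] = map g [0..<i]" if "i < Suc n" for i
      using that by (auto simp: map_eq_conv)
    then have "sq_queries_upto A (a v) (Suc n)"
      using True unfolding sq_queries_upto_def by metis
    then show ?thesis using valid vw by blast
  next
    case False
    \<comment> \<open>The time at which \<open>A\<close> halts on \<open>g\<close>; by then neither
      remaining vector has left the reference run.\<close>
    define j where "j = (LEAST j. \<forall>p. A (map g [0..<j]) \<noteq> Inl p)"
    obtain i where i: "i < Suc n" "\<forall>p. A (map g [0..<i]) \<noteq> Inl p"
      using False by (auto simp: sq_queries_upto_def)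
    have j: "\<forall>p. A (map g [0..<j]) \<noteq> Inl p" "j \<le> n"
      using LeastI[of "\<lambda>j. \<forall>p. A (map g [0..<j]) \<noteq> Inl p", OF i(2)]
        Least_le[of "\<lambda>j. \<forall>p. A (map g [0..<j]) \<noteq> Inl p", OF i(2)] i(1)
      unfolding j_def by auto
    have q: "sq_queries_upto A g j"
      unfolding sq_queries_upto_def j_def using not_less_Least by blast
    obtain u where u: "A (map g [0..<j]) = Inr u" using j(1) by (cases "A (map g [0..<j])") auto
    have "close z u" if z: "z \<in> S - (\<Union>i<n. Bad i)" for z
    proof -
      have ag: "map (a z) [0..<j] = map g [0..<j]" using agree z j q by blast
      then have "map (a z) [0..<i] = map g [0..<i]" if "i < j" for i
        using that by (auto simp: map_eq_conv)
      then have "sq_queries_upto A (a z) j"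
        using q unfolding sq_queries_upto_def by metis
      then have o: "sq_outputs A (a z) j u" unfolding sq_outputs_def ag using u by simp
      obtain n' u' where "sq_outputs A (a z) n' u'" "close z u'" using out[of z "a z"] z valid by blast
      then show ?thesis using sq_outputs_unique[OF o] by blast
    qed
    then have "close v u" "close w u" using vw(1,2) by blast+
    then have "v = w" using sep[of v w u] vw(1,2) by simp
    then show ?thesis using vw(3) by simp
  qed
qed

section \<open>Sparse unit vectors\<close>

text \<open>The first \<open>k * q\<close> coordinates form \<open>k\<close> blocks of length
  \<open>q\<close>, and the letter \<open>f j\<close> marks the one nonzero position in block
  \<open>j\<close>. Inner products then count agreements of words.\<close>

definition code_vec :: "nat \<Rightarrow> nat \<Rightarrow> nat \<Rightarrow> (nat \<Rightarrow> nat) \<Rightarrow> nat \<Rightarrow> real" where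
  "code_vec d k q f i = (if i < d then (if i < k * q \<and> f (i div q) = i mod q then 1 / sqrt (real k) else 0) else undefined)"

lemma dotp_code_vec:
  assumes kq: "k * q \<le> d" "0 < k" "0 < q"
    and f: "f \<in> {..<k} \<rightarrow>\<^sub>E {..<q}" and g: "g \<in> {..<k} \<rightarrow>\<^sub>E {..<q}"
  shows "dotp d (code_vec d k q f) (code_vec d k q g) = real (agree k f g) / real k"
proof -
  define h where "h i = (if f (i div q) = i mod q \<and> g (i div q) = i mod q then 1 / real k else 0)" for i
  have "dotp d (code_vec d k q f) (code_vec d k q g) = (\<Sum>i<k * q. h i)"
    unfolding dotp_def
    by (rule sum.mono_neutral_cong_right) (use kq in \<open>auto simp: code_vec_def h_def real_sqrt_mult[symmetric]\<close>)
  also have "\<dots> = (\<Sum>j<k. sum h {j * q..<j * q + q})"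
    by (rule sum.nat_group[symmetric])
  also have "\<dots> = (\<Sum>j<k. if f j = g j then 1 / real k else 0)"
  proof (rule sum.cong[OF refl])
    fix j assume j: "j \<in> {..<k}"
    then have fj: "f j < q" using f by auto
    have "sum h {j * q..<j * q + q} = (\<Sum>l<q. h (l + j * q))"
      using sum.shift_bounds_nat_ivl[of h 0 "j * q" q] by (simp add: add.commute lessThan_atLeast0)
    also have "\<dots> = (\<Sum>l<q. if l = f j then (if f j = g j then 1 / real k else 0) else 0)"
      using kq by (intro sum.cong) (auto simp: h_def)
    also have "\<dots> = (if f j = g j then 1 / real k else 0)" using fj by simp
    finally show "sum h {j * q..<j * q + q} = (if f j = g j then 1 / real k else 0)" .
  qed
  also have "\<dots> = (\<Sum>j\<in>{j\<in>{..<k}. f j = g j}. 1 / real k)"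
    by (rule sum.mono_neutral_cong_right) auto
  also have "\<dots> = real (agree k f g) / real k" by (simp add: agree_def)
  finally show ?thesis .
qed

lemma unit_vecI: "v \<in> extensional {0..<d} \<Longrightarrow> dotp d v v = 1 \<Longrightarrow> unit_vec d v"
  by (simp add: unit_vec_def l2norm_def dotp_def power2_eq_square)

lemma code_vec_unit_sparse:
  assumes kq: "k * q \<le> d" "0 < k" "0 < q" and f: "f \<in> {..<k} \<rightarrow>\<^sub>E {..<q}"
  shows "unit_vec d (code_vec d k q f)" and "sparse d k (code_vec d k q f)"
proof -
  have 1: "dotp d (code_vec d k q f) (code_vec d k q f) = 1"
    using dotp_code_vec[OF kq f f] kq by (simp add: agree_def)
  then show "unit_vec d (code_vec d k q f)"
    by (intro unit_vecI) (auto simp: code_vec_def extensional_def)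
  let ?Z = "{i\<in>{0..<d}. code_vec d k q f i \<noteq> 0}"
  \<comment> \<open>The support is counted through the norm: every nonzero coordinate contributes
    \<open>1 / k\<close>.\<close>
  have "dotp d (code_vec d k q f) (code_vec d k q f) = (\<Sum>i\<in>?Z. 1 / real k)"
    unfolding dotp_def
    by (rule sum.mono_neutral_cong_right) (auto simp: code_vec_def real_sqrt_mult[symmetric] split: if_splits)
  then have "real (card ?Z) = real k" using 1 kq by simp
  then show "sparse d k (code_vec d k q f)" by (simp add: sparse_def)
qed

text \<open>For \<open>s\<close> equal to 1 and -1, an antipodal pair that is sparse for every
  positive \<open>k\<close>. It serves the parameters for which no code is used.\<close>

definition pm_vec :: "nat \<Rightarrow> real \<Rightarrow> nat \<Rightarrow> real" where
  "pm_vec d s i = (if i < d then (if i = 0 then s else 0) else undefined)"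

lemma dotp_pm_vec: "1 \<le> d \<Longrightarrow> dotp d (pm_vec d s) (pm_vec d s') = s * s'"
proof -
  assume "1 \<le> d"
  have "dotp d (pm_vec d s) (pm_vec d s') = (\<Sum>i<d. if i = 0 then s * s' else 0)"
    unfolding dotp_def by (intro sum.cong) (auto simp: pm_vec_def)
  then show ?thesis using \<open>1 \<le> d\<close> by simp
qed

lemma pm_vec_unit_sparse:
  assumes "1 \<le> d" "1 \<le> k" "s * s = 1"
  shows "unit_vec d (pm_vec d s)" and "sparse d k (pm_vec d s)"
proof -
  show "unit_vec d (pm_vec d s)"
    using assms by (intro unit_vecI) (auto simp: dotp_pm_vec pm_vec_def extensional_def)
  have "card {i\<in>{0..<d}. pm_vec d s i \<noteq> 0} \<le> card {0::nat}"
    by (rule card_mono) (auto simp: pm_vec_def split: if_splits)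
  then show "sparse d k (pm_vec d s)" using assms by (simp add: sparse_def)
qed

text \<open>Provides the separation for the adversary: members of the families used have inner
  product at most 1/2. The argument even gives 7/8.\<close>

lemma close_imp_dotp_gt:
  assumes v: "unit_vec d v" and w: "unit_vec d w" and m: "0 < m"
    and c: "l2norm d (\<lambda>i. u i - m * v i) \<le> m / 4" "l2norm d (\<lambda>i. u i - m * w i) \<le> m / 4"
  shows "1 / 2 < dotp d v w"
proof -
  have sq: "(\<Sum>i<d. (u i - m * z i)\<^sup>2) \<le> m\<^sup>2 / 16" if "l2norm d (\<lambda>i. u i - m * z i) \<le> m / 4" for z
  proof -
    have "(l2norm d (\<lambda>i. u i - m * z i))\<^sup>2 \<le> (m / 4)\<^sup>2"
      using that by (intro power_mono) (auto simp: l2norm_def sum_nonneg)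
    then show ?thesis by (simp add: l2norm_def sum_nonneg power_divide)
  qed
  have "m\<^sup>2 * (2 - 2 * dotp d v w) = m\<^sup>2 * (dotp d v v + dotp d w w - 2 * dotp d v w)"
    using v w by (simp add: unit_vec_dotp)
  also have "\<dots> = (\<Sum>i<d. ((u i - m * w i) - (u i - m * v i))\<^sup>2)"
    by (simp add: dotp_def sum_distrib_left power2_eq_square algebra_simps flip: sum.distrib sum_subtractf)
  also have "\<dots> \<le> (\<Sum>i<d. 2 * (u i - m * w i)\<^sup>2 + 2 * (u i - m * v i)\<^sup>2)"
  proof (rule sum_mono)
    fix i
    have "(a - b)\<^sup>2 \<le> 2 * a\<^sup>2 + 2 * b\<^sup>2" for a b :: real
      using zero_le_power2[of "a + b"] by (simp add: power2_sum power2_diff)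
    then show "((u i - m * w i) - (u i - m * v i))\<^sup>2 \<le> 2 * (u i - m * w i)\<^sup>2 + 2 * (u i - m * v i)\<^sup>2" .
  qed
  also have "\<dots> \<le> m\<^sup>2 * (1 / 4)"
    using sq[OF c(1)] sq[OF c(2)] by (simp add: sum.distrib flip: sum_distrib_left)
  finally have "2 - 2 * dotp d v w \<le> 1 / 4" using m by (simp only: mult_le_cancel_left_pos zero_less_power)
  then show ?thesis by linarith
qed

text \<open>If \<open>d powr (3 * c / 8) < 2 * exp 1\<close>, then the query bound is at most this constant, and one query suffices.\<close>
definition code_const :: real where
  "code_const = (let Z = (2 * exp 1) powr (8 / 3) in Z powr (sqrt Z / 8))"

lemma code_const_ge_1: "1 \<le> code_const"
  unfolding code_const_def Let_def using exp_ge_add_one_self[of 1]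
  by (intro ge_one_powr_ge_zero) auto

text \<open>There are \<open>t\<close> factors with \<open>t\<close> at least
  \<open>k powr c\<close>, so each only has to reach \<open>d powr (c / 8)\<close>. As
  \<open>q\<close> is at least \<open>d / (2 * k)\<close> and \<open>k\<close> at most
  \<open>sqrt d\<close>, each is at least \<open>d powr (c / 2) / (2 * exp 1)\<close>.\<close>

lemma code_size:
  fixes d k :: nat and c :: real
  assumes k: "1 \<le> k" "k * k \<le> d" and c: "0 < c" "c < 1"
  defines "t \<equiv> nat \<lceil>real k powr c\<rceil>" and "q \<equiv> d div k"
    and "B \<equiv> real d powr (c * real k powr c / 8)"
  assumes W: "code_const < B"
  shows "B \<le> (real q * real t / (exp 1 * real k)) ^ t"
proof -
  have d: "1 \<le> d" using k by (metis le_trans mult_le_mono nat_mult_1)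
  have kd: "real k \<le> real d powr (1 / 2)"
  proof -
    have "real k * real k \<le> real d" using k by (metis of_nat_le_iff of_nat_mult)
    then have "real k \<le> sqrt (real d)" by (intro real_le_rsqrt) (simp add: power2_eq_square)
    then show ?thesis using d by (simp add: powr_half_sqrt)
  qed
  have kc: "real k powr c \<le> real d powr (c / 2)"
    using powr_mono2[OF less_imp_le[OF c(1)] _ kd] k by (simp add: powr_powr)
  define Z where "Z = (2 * exp 1 :: real) powr (8 / 3)"
  \<comment> \<open>The exponent is \<open>c / 2 - c / 8\<close>. If this fails,
    \<open>d powr c\<close> is at most \<open>Z\<close> and \<open>k powr c\<close> at most
    \<open>sqrt Z\<close>, so \<open>B\<close> is at most \<open>code_const\<close>.\<close>
  have big: "2 * exp 1 \<le> real d powr (3 * c / 8)"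
  proof (rule ccontr)
    assume "\<not> ?thesis"
    then have "(real d powr (3 * c / 8)) powr (8 / 3) \<le> Z"
      unfolding Z_def by (intro powr_mono2) auto
    then have dc: "real d powr c \<le> Z" by (simp add: powr_powr)
    have d1: "1 \<le> real d powr c" using d c by (intro ge_one_powr_ge_zero) auto
    have "real k powr c \<le> sqrt Z"
    proof -
      have "real d powr (c / 2) = sqrt (real d powr c)"
        by (simp add: powr_half_sqrt[symmetric] powr_powr)
      then show ?thesis using kc dc by (metis order_trans real_sqrt_le_mono)
    qed
    then have "(real d powr c) powr (real k powr c / 8) \<le> (real d powr c) powr (sqrt Z / 8)"
      using d1 by (intro powr_mono) auto
    also have "\<dots> \<le> Z powr (sqrt Z / 8)"
      using dc by (intro powr_mono2) (auto simp: Z_def)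
    finally have "B \<le> code_const" by (simp add: B_def code_const_def Z_def powr_powr)
    then show False using W by simp
  qed
  have kpos: "0 < real k" using k by simp
  have tc: "real k powr c \<le> real t" unfolding t_def by linarith
  have q1: "1 \<le> q" unfolding q_def using k by (simp add: div_greater_zero_iff Suc_le_eq) (metis le_square order_trans)
  have "d < (q + 1) * k" unfolding q_def using k by (simp add: dividend_less_div_times)
  also have "\<dots> \<le> 2 * q * k" using q1 by simp
  finally have "real d \<le> 2 * real q * real k" by (metis less_imp_le of_nat_le_iff of_nat_mult of_nat_numeral)
  then have qd: "real d / (2 * real k) \<le> real q" using kpos by (simp add: field_simps)
  have kk: "real d powr (c / 2 - 1) \<le> real k powr (c - 2)"
  proof -
    have "(real d powr (1 / 2)) powr (c - 2) \<le> real k powr (c - 2)"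
      using kd kpos c by (intro powr_mono2') auto
    then show ?thesis by (simp add: powr_powr diff_divide_distrib)
  qed
  have dpos: "0 < real d" using d by simp
  have "real d powr (c / 8) * (2 * exp 1) \<le> real d powr (c / 8) * real d powr (3 * c / 8)"
    using big by (intro mult_left_mono) auto
  also have "\<dots> = real d * real d powr (c / 2 - 1)"
    using dpos by (simp add: powr_add[symmetric] powr_diff)
  also have "\<dots> \<le> real d * real k powr (c - 2)"
    using kk by (intro mult_left_mono) auto
  also have "\<dots> = real d / (real k * real k) * real k powr c"
    using kpos by (simp add: powr_diff powr_numeral power2_eq_square)
  finally have "real d powr (c / 8) \<le> (real d / (2 * real k)) * real k powr c / (exp 1 * real k)"
    using kpos by (simp add: field_simps)
  also have "\<dots> \<le> real q * real t / (exp 1 * real k)"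
    using qd tc kpos by (intro divide_right_mono mult_mono) auto
  finally have Y: "real d powr (c / 8) \<le> real q * real t / (exp 1 * real k)" .
  have d8: "1 \<le> real d powr (c / 8)" using d c by (intro ge_one_powr_ge_zero) auto
  have "B = (real d powr (c / 8)) powr (real k powr c)" by (simp add: B_def powr_powr)
  also have "\<dots> \<le> (real d powr (c / 8)) powr (real t)" using d8 tc by (intro powr_mono) auto
  also have "\<dots> = (real d powr (c / 8)) ^ t" using d8 by (intro powr_realpow) linarith
  also have "\<dots> \<le> (real q * real t / (exp 1 * real k)) ^ t" using Y by (intro power_mono) auto
  finally show ?thesis .
qed

lemma exists_sparse_family:
  fixes d k :: nat and c :: real
  assumes k: "1 \<le> k" "k * k \<le> d" and c: "0 < c" "c < 1"
    and W: "code_const < real d powr (c * real k powr c / 8)" and r: "real k powr (c - 1) < 1"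
  shows "\<exists>S. finite S \<and> (\<forall>v\<in>S. unit_vec d v \<and> sparse d k v) \<and>
    (\<forall>u\<in>S. \<forall>v\<in>S. u \<noteq> v \<longrightarrow> \<bar>dotp d u v\<bar> \<le> real k powr (c - 1)) \<and>
    real d powr (c * real k powr c / 8) \<le> real (card S)"
proof -
  define t q where "t = nat \<lceil>real k powr c\<rceil>" and "q = d div k"
  have kpos: "0 < real k" using k by simp
  have t1: "t > 0" unfolding t_def using kpos by (simp add: powr_gt_zero)
  have "real k powr c \<le> real k powr 1" using k c by (intro powr_mono) auto
  then have "real k powr c \<le> real k" using kpos by simp
  then have tk: "t \<le> k" by (simp add: t_def ceiling_le_iff)
  have q1: "q > 0" unfolding q_def using k by (simp add: div_greater_zero_iff) (metis le_square order_trans)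
  have kq: "k * q \<le> d" by (simp add: q_def)
  obtain C where C: "C \<subseteq> {..<k} \<rightarrow>\<^sub>E {..<q}" "\<forall>f\<in>C. \<forall>g\<in>C. f \<noteq> g \<longrightarrow> agree k f g < t"
    "q ^ t \<le> card C * (k choose t)"
    using exists_code[OF tk q1 t1] by blast
  have fC: "finite C" using C(1) by (rule finite_subset) (intro finite_PiE; simp)
  let ?S = "code_vec d k q ` C"
  have dp: "dotp d (code_vec d k q f) (code_vec d k q g) = real (agree k f g) / real k" if "f \<in> C" "g \<in> C" for f g
    using that C(1) k q1 kq by (intro dotp_code_vec) auto
  have ub: "real (agree k f g) / real k \<le> real k powr (c - 1)" if "f \<in> C" "g \<in> C" "f \<noteq> g" for f g
  proof -
    have "agree k f g < t" using C(2) that by blast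
    \<comment> \<open>Since \<open>t\<close> is a ceiling, fewer than \<open>t\<close> agreements
      means at most \<open>k powr c\<close>.\<close>
    then have "real (agree k f g) \<le> real k powr c" unfolding t_def by linarith
    then show ?thesis using kpos by (simp add: powr_diff divide_right_mono)
  qed
  have inj: "inj_on (code_vec d k q) C"
  \<comment> \<open>Equal vectors have inner product 1, distinct words give less than 1 by
    \<open>r\<close>.\<close>
  proof (rule inj_onI, rule ccontr)
    fix f g assume fg: "f \<in> C" "g \<in> C" "code_vec d k q f = code_vec d k q g" "f \<noteq> g"
    have "real (agree k f f) / real k = real (agree k f g) / real k"
      using dp[OF fg(1,1)] dp[OF fg(1,2)] fg(3) by simp
    then show False using ub[OF fg(1,2,4)] r kpos by (simp add: agree_def)
  qed
  have ckt: "0 < real (k choose t)" using tk by (simp add: zero_less_binomial)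
  have "real d powr (c * real k powr c / 8) \<le> (real q * real t / (exp 1 * real k)) ^ t"
    using code_size[OF k c W] by (simp add: t_def q_def)
  also have "\<dots> = real q ^ t / (exp 1 * real k / real t) ^ t"
    using t1 by (simp add: power_divide power_mult_distrib)
  also have "\<dots> \<le> real q ^ t / real (k choose t)"
    using binomial_bound[OF t1, of k] ckt t1 kpos
    by (intro divide_left_mono mult_pos_pos zero_less_power divide_pos_pos) auto
  also have "\<dots> \<le> real (card C)"
  proof -
    have "real q ^ t \<le> real (card C) * real (k choose t)"
      using C(3) by (metis of_nat_le_iff of_nat_mult of_nat_power)
    then show ?thesis using ckt by (simp add: pos_divide_le_eq)
  qed
  finally have card: "real d powr (c * real k powr c / 8) \<le> real (card ?S)"
    by (simp add: card_image[OF inj])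
  have us: "\<forall>v\<in>?S. unit_vec d v \<and> sparse d k v"
    using C(1) k q1 kq by (auto intro!: code_vec_unit_sparse)
  have corr: "\<forall>u\<in>?S. \<forall>v\<in>?S. u \<noteq> v \<longrightarrow> \<bar>dotp d u v\<bar> \<le> real k powr (c - 1)"
  proof (intro ballI impI)
    fix u v assume "u \<in> ?S" "v \<in> ?S" "u \<noteq> v"
    then obtain f g where "f \<in> C" "g \<in> C" "f \<noteq> g" "u = code_vec d k q f" "v = code_vec d k q g" by auto
    then show "\<bar>dotp d u v\<bar> \<le> real k powr (c - 1)" using dp ub by simp
  qed
  show ?thesis using fC us corr card by (intro exI[of _ ?S]) simp
qed

section \<open>The lower bound\<close>

text \<open>The first part identifies the error of the reference answer. The second shows that the
  error never exceeds 2, which settles the range of large tolerances.\<close>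

lemma (in matched_exp_mixture) integral_tilt:
  assumes v: "dotp d v v = 1" and q0: "\<And>y. 0 \<le> q y" and [measurable]: "q \<in> borel_measurable borel"
    and f [measurable]: "f \<in> borel_measurable (stdG d)" and f1: "\<And>x. \<bar>f x\<bar> \<le> 1"
  shows "integral\<^sup>L (density (stdG d) (\<lambda>x. ennreal (q (dotp d v x)))) f - integral\<^sup>L (stdG d) f
      = (\<integral>x. f x * (q (dotp d v x) - 1) \<partial>stdG d)"
    and "\<bar>\<integral>x. f x * (q (dotp d v x) - 1) \<partial>stdG d\<bar> \<le> 2"
proof -
  interpret G: prob_space "stdG d" by (rule prob_space_stdG)
  have I: "integrable (stdG d) (\<lambda>x. q (dotp d v x))" "(\<integral>x. q (dotp d v x) \<partial>stdG d) = 1"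
    using integral_q[OF v] by (auto simp: has_bochner_integral_iff)
  have If: "integrable (stdG d) f"
    by (rule G.integrable_const_bound[where B = 1]) (use f1 in auto)
  have Ifq: "integrable (stdG d) (\<lambda>x. f x * q (dotp d v x))"
    by (rule Bochner_Integration.integrable_bound[OF I(1)])
      (use f1 q0 in \<open>auto simp: abs_mult intro!: mult_left_le_one_le\<close>)
  have "integral\<^sup>L (density (stdG d) (\<lambda>x. ennreal (q (dotp d v x)))) f = (\<integral>x. q (dotp d v x) * f x \<partial>stdG d)"
    by (rule integral_real_density) (use q0 in auto)
  then show "integral\<^sup>L (density (stdG d) (\<lambda>x. ennreal (q (dotp d v x)))) f - integral\<^sup>L (stdG d) f
      = (\<integral>x. f x * (q (dotp d v x) - 1) \<partial>stdG d)"
    using If Ifq by (simp add: algebra_simps)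
  have "\<bar>\<integral>x. f x * (q (dotp d v x) - 1) \<partial>stdG d\<bar> \<le> (\<integral>x. \<bar>f x * (q (dotp d v x) - 1)\<bar> \<partial>stdG d)"
    by (rule integral_abs_bound)
  also have "\<dots> \<le> (\<integral>x. q (dotp d v x) + 1 \<partial>stdG d)"
  proof (rule integral_mono)
    show "integrable (stdG d) (\<lambda>x. \<bar>f x * (q (dotp d v x) - 1)\<bar>)"
      using If Ifq by (simp add: right_diff_distrib)
    show "integrable (stdG d) (\<lambda>x. q (dotp d v x) + 1)" using I by simp
    fix x
    have "\<bar>f x * (q (dotp d v x) - 1)\<bar> \<le> \<bar>q (dotp d v x) - 1\<bar>"
      using f1[of x] by (simp add: abs_mult mult_left_le_one_le)
    also have "\<dots> \<le> q (dotp d v x) + 1" using q0[of "dotp d v x"] by linarith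
    finally show "\<bar>f x * (q (dotp d v x) - 1)\<bar> \<le> q (dotp d v x) + 1" .
  qed
  also have "\<dots> = 2" using I by (simp add: G.prob_space)
  finally show "\<bar>\<integral>x. f x * (q (dotp d v x) - 1) \<partial>stdG d\<bar> \<le> 2" .
qed

text \<open>The one-sided count is applied to \<open>f\<close> and to its negative, hence the factor
  2.\<close>

lemma (in matched_exp_mixture) card_far_le:
  assumes S: "finite S" and unit: "\<And>v. v \<in> S \<Longrightarrow> dotp d v v = 1"
    and corr: "\<And>u v. u \<in> S \<Longrightarrow> v \<in> S \<Longrightarrow> u \<noteq> v \<Longrightarrow> \<bar>dotp d u v\<bar> \<le> r"
    and r: "0 < r" "r \<le> 1" and \<tau>: "0 < \<tau>" "22 * r ^ 4 * \<Gamma>\<^sup>2 \<le> \<tau>\<^sup>2"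
    and f [measurable]: "f \<in> borel_measurable (stdG d)" and f1: "\<And>x. \<bar>f x\<bar> \<le> 1"
  shows "card {v\<in>S. \<tau> < \<bar>\<integral>x. f x * (q (dotp d v x) - 1) \<partial>stdG d\<bar>} \<le> 2 / r ^ 4"
proof -
  let ?I = "\<lambda>f v. \<integral>x. f x * (q (dotp d v x) - 1) \<partial>stdG d"
  have *: "card {v\<in>S. \<tau> < ?I g v} \<le> 1 / r ^ 4"
    if [measurable]: "g \<in> borel_measurable (stdG d)" and "\<And>x. \<bar>g x\<bar> \<le> 1" for g
  proof -
    have "card {v\<in>S. \<tau> < ?I g v} * r ^ 4 \<le> 1"
      by (rule card_distinguished_le[where f = g]) (use S unit corr r \<tau> that in auto)
    then show ?thesis using r by (simp add: field_simps)
  qed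
  have "{v\<in>S. \<tau> < \<bar>?I f v\<bar>} \<subseteq> {v\<in>S. \<tau> < ?I f v} \<union> {v\<in>S. \<tau> < ?I (\<lambda>x. - f x) v}"
    by auto
  then have "card {v\<in>S. \<tau> < \<bar>?I f v\<bar>} \<le> card ({v\<in>S. \<tau> < ?I f v} \<union> {v\<in>S. \<tau> < ?I (\<lambda>x. - f x) v})"
    using S by (intro card_mono) auto
  also have "\<dots> \<le> card {v\<in>S. \<tau> < ?I f v} + card {v\<in>S. \<tau> < ?I (\<lambda>x. - f x) v}"
    by (rule card_Un_le)
  finally have "real (card {v\<in>S. \<tau> < \<bar>?I f v\<bar>}) \<le> real (card {v\<in>S. \<tau> < ?I f v}) + real (card {v\<in>S. \<tau> < ?I (\<lambda>x. - f x) v})"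
    by linarith
  also have "\<dots> \<le> 1 / r ^ 4 + 1 / r ^ 4" by (intro add_mono *) (use f1 in auto)
  finally show ?thesis by simp
qed

text \<open>Three ranges of parameters. If \<open>k powr (c - 1)\<close> is at least 1/2, the
  tolerance exceeds every possible error and the antipodal pair defeats any number of queries. If
  the claimed bound is below 1, a single query is enough, again by that pair. Otherwise the sparse
  code exists.\<close>

lemma sq_query_lower_bound:
  fixes d k :: nat and c eps :: real
    and A :: "real list \<Rightarrow> ((nat \<Rightarrow> real) \<Rightarrow> real) \<times> real + (nat \<Rightarrow> real)"
  assumes d: "1 \<le> d" and k: "1 \<le> k" "real k \<le> sqrt (real d)" and c: "0 < c" "c < 1"
    and eps: "0 < eps" "eps < 1/2" and wf: "sq_wellformed d A"
    and out: "\<And>v B ans. unit_vec d v \<Longrightarrow> sparse d k v \<Longrightarrow> admissible_noise d B \<Longrightarrow>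
        sq_valid_answers A (hard_dist d eps v B) ans \<Longrightarrow>
        \<exists>n u. sq_outputs A ans n u \<and> l2norm d (\<lambda>i. u i - c1 * sqrt eps * v i) \<le> c1 * sqrt eps / 4"
    and tol: "\<And>v B ans i f tau. unit_vec d v \<Longrightarrow> sparse d k v \<Longrightarrow> admissible_noise d B \<Longrightarrow>
        sq_valid_answers A (hard_dist d eps v B) ans \<Longrightarrow> sq_queries_upto A ans i \<Longrightarrow>
        A (map ans [0..<i]) = Inl (f, tau) \<Longrightarrow> 5 * real k powr (-2 + 2 * c) * exp (9 / eps) < tau"
  shows "\<exists>v B ans n. unit_vec d v \<and> sparse d k v \<and> admissible_noise d B \<and>
      sq_valid_answers A (hard_dist d eps v B) ans \<and> sq_queries_upto A ans n \<and>
      real n \<ge> 1 / (4 * code_const) * real d powr (c * real k powr c / 8) * real k powr (-4 + 4 * c)"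
proof (rule hard_mixture_exists[OF eps])
  fix M :: "(nat \<times> real) measure" and \<theta> q b
  assume mix: "matched_exp_mixture M \<theta> q" and G: "exp_mixture.\<Gamma> M \<theta> \<le> exp (9 / eps)"
    and q0: "\<And>y. 0 \<le> q y" and qm: "q \<in> borel_measurable borel"
    and noise: "\<And>d v. unit_vec d v \<Longrightarrow> admissible_noise d (density (stdG d) (\<lambda>x. ennreal (b (dotp d v x))))"
    and hard: "\<And>d v. unit_vec d v \<Longrightarrow> hard_dist d eps v (density (stdG d) (\<lambda>x. ennreal (b (dotp d v x))))
      = density (stdG d) (\<lambda>x. ennreal (q (dotp d v x)))"
  interpret matched_exp_mixture M \<theta> q by (rule mix)
  define B where "B v = density (stdG d) (\<lambda>x. ennreal (b (dotp d v x)))" for v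
  define \<tau> where "\<tau> = 5 * real k powr (-2 + 2 * c) * exp (9 / eps)"
  define r where "r = real k powr (c - 1)"
  have kpos: "0 < real k" using k by simp
  have r0: "0 < r" "r \<le> 1"
    unfolding r_def using k c powr_mono[of "c - 1" 0 "real k"] by auto
  have r2: "real k powr (-2 + 2 * c) = r\<^sup>2" and r4: "real k powr (-4 + 4 * c) = r ^ 4"
    unfolding r_def using kpos by (simp_all add: powr_powr[symmetric] powr_realpow[symmetric] powr_powr algebra_simps)
  have \<tau>r: "\<tau> = 5 * r\<^sup>2 * exp (9 / eps)" by (simp only: \<tau>_def r2)
  have \<tau>0: "0 < \<tau>" using r0 by (simp add: \<tau>r)
  \<comment> \<open>The factor 5 in the tolerance is chosen so that its square is at least
    22.\<close>
  have \<tau>2: "22 * r ^ 4 * \<Gamma>\<^sup>2 \<le> \<tau>\<^sup>2"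
  proof -
    have "\<Gamma>\<^sup>2 \<le> (exp (9 / eps))\<^sup>2" using G \<Gamma>_ge_1 by (intro power_mono) auto
    then have "22 * r ^ 4 * \<Gamma>\<^sup>2 \<le> 25 * r ^ 4 * (exp (9 / eps))\<^sup>2"
      using r0 by (intro mult_mono) auto
    also have "\<dots> = \<tau>\<^sup>2" by (simp add: \<tau>r power_mult_distrib flip: power_mult)
    finally show ?thesis .
  qed
  have wfD: "f \<in> borel_measurable (stdG d)" "\<And>x. \<bar>f x\<bar> \<le> 1" "0 < tau" if "A h = Inl (f, tau)" for h f tau
    using wf that unfolding sq_wellformed_def by (auto cong: measurable_cong_sets simp: sets_stdG measurable_cong_sets[OF sets_stdG refl])
  have mu: "0 < c1 * sqrt eps" using eps by (simp add: c1_def)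
  let ?good = "\<lambda>n. \<exists>v B ans. unit_vec d v \<and> sparse d k v \<and> admissible_noise d B \<and>
      sq_valid_answers A (hard_dist d eps v B) ans \<and> sq_queries_upto A ans n"
  have adv: "?good (Suc n)"
    if S: "finite S" "\<And>v. v \<in> S \<Longrightarrow> unit_vec d v \<and> sparse d k v"
      "\<And>u v. u \<in> S \<Longrightarrow> v \<in> S \<Longrightarrow> u \<noteq> v \<Longrightarrow> dotp d u v \<le> 1 / 2"
    and m: "0 \<le> m" "real n * m + 2 \<le> real (card S)"
    and few: "\<And>f. f \<in> borel_measurable (stdG d) \<Longrightarrow> (\<And>x. \<bar>f x\<bar> \<le> 1) \<Longrightarrow>
      card {v\<in>S. \<tau> < \<bar>\<integral>x. f x * (q (dotp d v x) - 1) \<partial>stdG d\<bar>} \<le> m"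
    for S :: "(nat \<Rightarrow> real) set" and n and m :: real
  proof -
    have "\<exists>v\<in>S. \<exists>ans. sq_valid_answers A (hard_dist d eps v (B v)) ans \<and> sq_queries_upto A ans (Suc n)"
    proof (rule sq_adversary[where D = "\<lambda>v. hard_dist d eps v (B v)" and m = m and tol = \<tau> and e = "\<lambda>f. integral\<^sup>L (stdG d) f"
          and close = "\<lambda>v u. l2norm d (\<lambda>i. u i - c1 * sqrt eps * v i) \<le> c1 * sqrt eps / 4"])
      show "finite S" by (rule S)
      show "0 \<le> m" "real n * m + 2 \<le> real (card S)" by (rule m)+
      show "0 < tau" if "A h = Inl (f, tau)" for h f tau using wfD(3)[OF that] .
      show "\<exists>n u. sq_outputs A ans n u \<and> l2norm d (\<lambda>i. u i - c1 * sqrt eps * v i) \<le> c1 * sqrt eps / 4"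
        if "v \<in> S" "sq_valid_answers A (hard_dist d eps v (B v)) ans" for v ans
        using out[OF _ _ _ that(2)] S(2)[OF that(1)] noise[of d v] unfolding B_def by blast
      show "v = w" if "v \<in> S" "w \<in> S" "l2norm d (\<lambda>i. u i - c1 * sqrt eps * v i) \<le> c1 * sqrt eps / 4"
        "l2norm d (\<lambda>i. u i - c1 * sqrt eps * w i) \<le> c1 * sqrt eps / 4" for u v w
        using close_imp_dotp_gt[OF _ _ mu that(3,4)] S(2)[OF that(1)] S(2)[OF that(2)] S(3)[OF that(1,2)]
        by linarith
      show "\<tau> < tau" if "v \<in> S" "sq_valid_answers A (hard_dist d eps v (B v)) ans" "sq_queries_upto A ans i"
        "A (map ans [0..<i]) = Inl (f, tau)" for v ans i f tau
        using tol[OF _ _ _ that(2-4)] S(2)[OF that(1)] noise[of d v] unfolding B_def \<tau>_def by blast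
      show "real (card {v\<in>S. \<tau> < \<bar>integral\<^sup>L (hard_dist d eps v (B v)) f - integral\<^sup>L (stdG d) f\<bar>}) \<le> m"
        if "A h = Inl (f, tau)" for h f tau
      proof -
        note f = wfD(1,2)[OF that]
        have "integral\<^sup>L (hard_dist d eps v (B v)) f - integral\<^sup>L (stdG d) f
           = (\<integral>x. f x * (q (dotp d v x) - 1) \<partial>stdG d)" if "v \<in> S" for v
          using integral_tilt(1)[OF unit_vec_dotp q0 qm f] S(2)[OF that] hard[of d v] by (simp add: B_def)
        then have "{v\<in>S. \<tau> < \<bar>integral\<^sup>L (hard_dist d eps v (B v)) f - integral\<^sup>L (stdG d) f\<bar>}
          = {v\<in>S. \<tau> < \<bar>\<integral>x. f x * (q (dotp d v x) - 1) \<partial>stdG d\<bar>}" by auto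
        then show ?thesis using few[OF f] by simp
      qed
    qed
    then show ?thesis using S(2) noise unfolding B_def by blast
  qed
  define X where "X = 1 / (4 * code_const) * real d powr (c * real k powr c / 8) * real k powr (-4 + 4 * c)"
  have X0: "0 \<le> X" using code_const_ge_1 by (simp add: X_def)
  \<comment> \<open>The adversary forces one query more than \<open>n\<close>, so rounding down
    loses nothing.\<close>
  define n where "n = nat \<lfloor>X\<rfloor>"
  have nX: "real n \<le> X" "X \<le> real (Suc n)" using X0 unfolding n_def by linarith+
  let ?P = "{pm_vec d 1, pm_vec d (-1)}"
  have neq: "pm_vec d 1 \<noteq> pm_vec d (-1)" using d by (auto simp: fun_eq_iff pm_vec_def intro!: exI[of _ 0])
  have P: "finite ?P" "\<And>v. v \<in> ?P \<Longrightarrow> unit_vec d v \<and> sparse d k v"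
    "\<And>u v. u \<in> ?P \<Longrightarrow> v \<in> ?P \<Longrightarrow> u \<noteq> v \<Longrightarrow> dotp d u v \<le> 1 / 2" "card ?P = 2"
    using d k(1) neq pm_vec_unit_sparse[of d k 1] pm_vec_unit_sparse[of d k "-1"] by (auto simp: dotp_pm_vec)
  have "?good (Suc n)"
  proof (cases "1 / 2 \<le> r")
    case True
    \<comment> \<open>A query of such a large tolerance cannot distinguish any two distributions.\<close>
    have "2 \<le> \<tau>"
    proof -
      have "(1 / 2)\<^sup>2 \<le> r\<^sup>2" using True by (intro power_mono) auto
      moreover have "9 \<le> 9 / eps" using eps by (simp add: field_simps)
      then have "8 \<le> exp (9 / eps)" using exp_ge_add_one_self[of "9 / eps"] by linarith
      ultimately have "(1 / 4) * 8 \<le> r\<^sup>2 * exp (9 / eps)" by (intro mult_mono) (auto simp: power2_eq_square)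
      then show ?thesis by (simp add: \<tau>r)
    qed
    then have "{v\<in>?P. \<tau> < \<bar>\<integral>x. f x * (q (dotp d v x) - 1) \<partial>stdG d\<bar>} = {}"
      if "f \<in> borel_measurable (stdG d)" "\<And>x. \<bar>f x\<bar> \<le> 1" for f
      using integral_tilt(2)[OF unit_vec_dotp q0 qm that] P(2) by fastforce
    then show ?thesis using P by (intro adv[of ?P 0]) auto
  next
    case False
    show ?thesis
    proof (cases "X < 1")
      case True
      \<comment> \<open>With \<open>n = 0\<close> the pair meets the counting condition whatever a
        query reveals: \<open>A\<close> cannot halt without asking.\<close>
      then have n0: "n = 0" using X0 by (simp add: n_def floor_eq_iff)
      show ?thesis
      proof (rule adv[of ?P 2])
        show "real (card {v\<in>?P. \<tau> < \<bar>\<integral>x. f x * (q (dotp d v x) - 1) \<partial>stdG d\<bar>}) \<le> 2" for f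
          using card_mono[of ?P "{v\<in>?P. \<tau> < \<bar>\<integral>x. f x * (q (dotp d v x) - 1) \<partial>stdG d\<bar>}"] P(4) by auto
      qed (use P n0 in auto)
    next
      case X1: False
      define Y where "Y = real d powr (c * real k powr c / 8)"
      have XY: "X = Y * r ^ 4 / (4 * code_const)" unfolding X_def Y_def r4 by simp
      have r41: "r ^ 4 \<le> 1" "0 < r ^ 4" using r0 by (auto simp: power_le_one)
      have Y0: "0 \<le> Y" by (simp add: Y_def)
      have "Y * r ^ 4 \<le> Y" using r41 Y0 by (simp add: mult_left_le)
      moreover have "4 * code_const \<le> Y * r ^ 4" using X1 code_const_ge_1 by (simp add: XY field_simps)
      \<comment> \<open>This makes the code available and, since it forces \<open>Y\<close> to be at
        least 4, also pays for the two vectors that must remain.\<close>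
      ultimately have WY: "4 * code_const \<le> Y" by linarith
      have "k * k \<le> d"
      proof -
        have "(real k)\<^sup>2 \<le> (sqrt (real d))\<^sup>2" using k(2) by (intro power_mono) auto
        then show ?thesis by (simp add: power2_eq_square flip: of_nat_mult)
      qed
      moreover have "r < 1" using False by simp
      moreover have "code_const < Y" using WY code_const_ge_1 by linarith
      ultimately obtain S where S: "finite S" "\<forall>v\<in>S. unit_vec d v \<and> sparse d k v"
        "\<forall>u\<in>S. \<forall>v\<in>S. u \<noteq> v \<longrightarrow> \<bar>dotp d u v\<bar> \<le> r" "Y \<le> real (card S)"
        using exists_sparse_family[of k d c] k(1) c unfolding r_def Y_def by auto
      show ?thesis
      proof (rule adv[of S "2 / r ^ 4"])
        show "dotp d u v \<le> 1 / 2" if "u \<in> S" "v \<in> S" "u \<noteq> v" for u v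
          using S(3) that False by fastforce
        have "real n * (2 / r ^ 4) \<le> X * (2 / r ^ 4)" using nX r41 by (intro mult_right_mono) auto
        also have "\<dots> = Y / (2 * code_const)" using r41 by (simp add: XY)
        also have "\<dots> \<le> Y / 2" using code_const_ge_1 Y0 by (intro divide_left_mono) auto
        finally have "real n * (2 / r ^ 4) \<le> Y / 2" .
        then show "real n * (2 / r ^ 4) + 2 \<le> real (card S)" using S(4) WY code_const_ge_1 by linarith
        show "real (card {v\<in>S. \<tau> < \<bar>\<integral>x. f x * (q (dotp d v x) - 1) \<partial>stdG d\<bar>}) \<le> 2 / r ^ 4"
          if "f \<in> borel_measurable (stdG d)" "\<And>x. \<bar>f x\<bar> \<le> 1" for f
          by (rule card_far_le) (use S unit_vec_dotp r0 \<tau>0 \<tau>2 that in auto)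
      qed (use S r41 in auto)
    qed
  qed
  then show "\<exists>v B ans n. unit_vec d v \<and> sparse d k v \<and> admissible_noise d B \<and>
      sq_valid_answers A (hard_dist d eps v B) ans \<and> sq_queries_upto A ans n \<and>
      real n \<ge> 1 / (4 * code_const) * real d powr (c * real k powr c / 8) * real k powr (-4 + 4 * c)"
    using nX(2) unfolding X_def by blast
qed

lemma inverse_code_const_pos: "0 < 1 / (4 * code_const)"
  using code_const_ge_1 by simp

theorem theorem6p11:
  "\<exists>C1>0. \<exists>C2>0. \<exists>C3>0.
    \<forall>(d::nat) (k::nat) (c::real) (eps::real)
      (A :: real list \<Rightarrow> ((nat \<Rightarrow> real) \<Rightarrow> real) \<times> real + (nat \<Rightarrow> real)).
      d \<ge> 1 \<longrightarrow> k \<ge> 1 \<longrightarrow> real k \<le> sqrt (real d) \<longrightarrow> 0 < c \<longrightarrow> c < 1 \<longrightarrow>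
      0 < eps \<longrightarrow> eps < 1/2 \<longrightarrow> sq_wellformed d A \<longrightarrow>
      (\<forall>v B ans. unit_vec d v \<longrightarrow> sparse d k v \<longrightarrow> admissible_noise d B \<longrightarrow>
          sq_valid_answers A (hard_dist d eps v B) ans \<longrightarrow>
          (\<exists>n u. sq_outputs A ans n u \<and>
                 l2norm d (\<lambda>i. u i - c1 * sqrt eps * v i) \<le> c1 * sqrt eps / 4)) \<longrightarrow>
      (\<exists>v B ans n. unit_vec d v \<and> sparse d k v \<and> admissible_noise d B \<and>
          sq_valid_answers A (hard_dist d eps v B) ans \<and> sq_queries_upto A ans n \<and>
          real n \<ge> C1 * real d powr (c * real k powr c / 8) * real k powr (-4 + 4 * c))
      \<or>
      (\<exists>v B ans i f tau. unit_vec d v \<and> sparse d k v \<and> admissible_noise d B \<and>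
          sq_valid_answers A (hard_dist d eps v B) ans \<and> sq_queries_upto A ans i \<and>
          A (map ans [0..<i]) = Inl (f, tau) \<and>
          tau \<le> C2 * real k powr (-2 + 2 * c) * exp (C3 / eps))"
proof (rule exI[of _ "1 / (4 * code_const)"], rule conjI, rule inverse_code_const_pos,
    rule exI[of _ 5], rule conjI, rule zero_less_numeral,
    rule exI[of _ 9], rule conjI, rule zero_less_numeral, intro allI impI)
  fix d k :: nat and c eps :: real
    and A :: "real list \<Rightarrow> ((nat \<Rightarrow> real) \<Rightarrow> real) \<times> real + (nat \<Rightarrow> real)"
  assume H: "1 \<le> d" "1 \<le> k" "real k \<le> sqrt (real d)" "0 < c" "c < 1" "0 < eps" "eps < 1/2" "sq_wellformed d A"
    and out: "\<forall>v B ans. unit_vec d v \<longrightarrow> sparse d k v \<longrightarrow> admissible_noise d B \<longrightarrow>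
          sq_valid_answers A (hard_dist d eps v B) ans \<longrightarrow>
          (\<exists>n u. sq_outputs A ans n u \<and>
                 l2norm d (\<lambda>i. u i - c1 * sqrt eps * v i) \<le> c1 * sqrt eps / 4)"
  show "(\<exists>v B ans n. unit_vec d v \<and> sparse d k v \<and> admissible_noise d B \<and>
          sq_valid_answers A (hard_dist d eps v B) ans \<and> sq_queries_upto A ans n \<and>
          real n \<ge> 1 / (4 * code_const) * real d powr (c * real k powr c / 8) * real k powr (-4 + 4 * c))
      \<or>
      (\<exists>v B ans i f tau. unit_vec d v \<and> sparse d k v \<and> admissible_noise d B \<and>
          sq_valid_answers A (hard_dist d eps v B) ans \<and> sq_queries_upto A ans i \<and>
          A (map ans [0..<i]) = Inl (f, tau) \<and>
          tau \<le> 5 * real k powr (-2 + 2 * c) * exp (9 / eps))"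
    (is "?Q \<or> ?T")
  proof (rule disjCI)
    assume nT: "\<not> ?T"
    show ?Q
    proof (rule sq_query_lower_bound[OF H])
      show "\<exists>n u. sq_outputs A ans n u \<and> l2norm d (\<lambda>i. u i - c1 * sqrt eps * v i) \<le> c1 * sqrt eps / 4"
        if "unit_vec d v" "sparse d k v" "admissible_noise d B" "sq_valid_answers A (hard_dist d eps v B) ans"
        for v B ans
        using out that by blast
      show "5 * real k powr (-2 + 2 * c) * exp (9 / eps) < tau"
        if "unit_vec d v" "sparse d k v" "admissible_noise d B" "sq_valid_answers A (hard_dist d eps v B) ans"
          "sq_queries_upto A ans i" "A (map ans [0..<i]) = Inl (f, tau)" for v B ans i f tau
        using nT that not_le by blast
    qed
  qed
qed

end
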